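(* Let $\alpha\in(0,2)$, let $X=(x_{ij})$ be the $N\times n$ heavy-tailed random matrix described in the context, with tail exponent $\alpha$, and suppose that $x_{11}$ is symmetrically distributed. Let $\mathfrak{u}=(\mathfrak u_1,\dots,\mathfrak u_n)$ be the bottom singular vector of $X$. Then for any $\delta\in(0,1)$ and $K>0$ there exists a constant $c=c(\alpha,\delta,K)>0$ such that, defining the (random) index set $$\hat I=\hat I(\mathfrak u)=\Big\{i\in[n]:|\mathfrak u_i|>\sqrt{\tfrac{c\log n}{n}}\Big\},$$ we have $\|\mathfrak u_{\hat I}\|_2\ge\sqrt{1-\delta}$ with probability at least $1-O(n^{-K})$.
   Context: Model: $\mathsf a>1$ is a constant, $N=\lceil \mathsf a n\rceil$, and $X=(x_{ij})$ is an $N\times n$ real random matrix with i.i.d. entries whose law does not depend on $n$ and satisfies, for some constants $\alpha,C_\ell,C_u,T_0>0$, $C_\ell t^{-\alpha}\le \mathbb P\{|x_{11}|>t\}\le C_u t^{-\alpha}$ for all $t\ge T_0$. "Symmetrically distributed" means $x_{11}$ and $-x_{11}$ have the same law. The bottom singular vector $\mathfrak u$ is the unit (in $\ell^2$) right singular vector of $X$ corresponding to the smallest singular value $s_{\min}(X)=\inf_{\|u\|_2=1}\|Xu\|_2$, so $\|X\mathfrak u\|_2=s_{\min}(X)$. Notation: $[n]=\{1,\dots,n\}$; for a vector $x\in\mathbb R^n$ and $I\subseteq[n]$, $x_I\in\mathbb R^{|I|}$ is obtained by deleting the components with indices in $I^c$. The model ($\mathsf a$ and the law of $x_{11}$) is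 fixed and asymptotics are as $n\to\infty$; constants do not depend on $n$. *)

theory Defs
  imports "HOL-Probability.Probability"
begin

text \<open>Vectors of length \<open>n\<close> and \<open>N \<times> n\<close> matrices are functions on natural-number indices, of which
  only the values at \<open>{1..n}\<close> and \<open>{1..N} \<times> {1..n}\<close> matter. Hence \<open>L2_set u I\<close> is the Euclidean
  norm of the vector obtained from \<open>u\<close> by deleting the components outside \<open>I\<close>.\<close>

definition mat_vec :: "nat \<Rightarrow> (nat \<Rightarrow> nat \<Rightarrow> real) \<Rightarrow> (nat \<Rightarrow> real) \<Rightarrow> nat \<Rightarrow> real" where
  "mat_vec n A u = (\<lambda>i. \<Sum>j\<in>{1..n}. A i j * u j)"

definition s_min :: "nat \<Rightarrow> nat \<Rightarrow> (nat \<Rightarrow> nat \<Rightarrow> real) \<Rightarrow> real" where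
  "s_min N n A = (INF u\<in>{u. L2_set u {1..n} = 1}. L2_set (mat_vec n A u) {1..N})"

text \<open>The unit vector \<open>v\<close> is the corresponding left singular vector.\<close>

definition right_singular_vector ::
    "nat \<Rightarrow> nat \<Rightarrow> (nat \<Rightarrow> nat \<Rightarrow> real) \<Rightarrow> real \<Rightarrow> (nat \<Rightarrow> real) \<Rightarrow> bool" where
  "right_singular_vector N n A s u \<longleftrightarrow>
     L2_set u {1..n} = 1 \<and>
     (\<exists>v. L2_set v {1..N} = 1 \<and>
        (\<forall>i\<in>{1..N}. mat_vec n A u i = s * v i) \<and>
        (\<forall>j\<in>{1..n}. mat_vec N (\<lambda>j i. A i j) v j = s * u j))"

text \<open>The smallest singular value may be degenerate (or zero), and \<open>u\<close> is at best unique up to sign;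
  any unit vector of the singular space qualifies.\<close>

definition bottom_singular_vector ::
    "nat \<Rightarrow> nat \<Rightarrow> (nat \<Rightarrow> nat \<Rightarrow> real) \<Rightarrow> (nat \<Rightarrow> real) \<Rightarrow> bool" where
  "bottom_singular_vector N n A u \<longleftrightarrow> right_singular_vector N n A (s_min N n A) u"

lemma s_min_nonneg:
  assumes "n \<ge> 1"
  shows "s_min N n A \<ge> 0"
proof -
  have "L2_set (\<lambda>i. if i = 1 then 1 else 0 :: real) {1..n} = 1"
    using assms by (simp add: L2_set_def if_distrib[of "\<lambda>x. x\<^sup>2"] cong: if_cong)
  then have "{u :: nat \<Rightarrow> real. L2_set u {1..n} = 1} \<noteq> {}" by blast
  then show ?thesis unfolding s_min_def by (rule cINF_greatest) (rule L2_set_nonneg)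
qed

lemma bottom_singular_vector_attains:
  assumes "n \<ge> 1" "bottom_singular_vector N n A u"
  shows "L2_set (mat_vec n A u) {1..N} = s_min N n A"
proof -
  obtain v where v: "L2_set v {1..N} = 1"
      "\<And>i. i \<in> {1..N} \<Longrightarrow> mat_vec n A u i = s_min N n A * v i"
    using assms(2) unfolding bottom_singular_vector_def right_singular_vector_def by blast
  have "L2_set (mat_vec n A u) {1..N} = L2_set (\<lambda>i. s_min N n A * v i) {1..N}"
    by (rule L2_set_cong) (use v(2) in auto)
  also have "\<dots> = s_min N n A * L2_set v {1..N}"
    by (rule L2_set_right_distrib[symmetric]) (rule s_min_nonneg[OF assms(1)])
  finally show ?thesis using v(1) by simp
qed

definition heavy_tailed :: "real measure \<Rightarrow> real \<Rightarrow> real \<Rightarrow> real \<Rightarrow> real \<Rightarrow> bool" where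
  "heavy_tailed \<mu> \<alpha> C\<^sub>l C\<^sub>u T\<^sub>0 \<longleftrightarrow>
     (\<forall>t\<ge>T\<^sub>0. C\<^sub>l * t powr (-\<alpha>) \<le> measure \<mu> {x. \<bar>x\<bar> > t} \<and>
             measure \<mu> {x. \<bar>x\<bar> > t} \<le> C\<^sub>u * t powr (-\<alpha>))"

definition symmetrically_distributed :: "real measure \<Rightarrow> bool" where
  "symmetrically_distributed \<mu> \<longleftrightarrow> distr \<mu> borel (\<lambda>x. - x) = \<mu>"

definition iid_matrix ::
    "'w measure \<Rightarrow> real measure \<Rightarrow> nat \<Rightarrow> nat \<Rightarrow> ('w \<Rightarrow> nat \<Rightarrow> nat \<Rightarrow> real) \<Rightarrow> bool" where
  "iid_matrix M \<mu> N n X \<longleftrightarrow>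
     prob_space.indep_vars M (\<lambda>_. borel) (\<lambda>(i, j) \<omega>. X \<omega> i j) ({1..N} \<times> {1..n}) \<and>
     (\<forall>i\<in>{1..N}. \<forall>j\<in>{1..n}. distr M borel (\<lambda>\<omega>. X \<omega> i j) = \<mu>)"

definition I_hat :: "real \<Rightarrow> nat \<Rightarrow> (nat \<Rightarrow> real) \<Rightarrow> nat set" where
  "I_hat c n u = {i\<in>{1..n}. \<bar>u i\<bar> > sqrt (c * ln (real n) / real n)}"

end

theory Submission
  imports Defs "HOL-Real_Asymp.Real_Asymp"
begin

text \<open>Put \<open>D = n\<^bsup>1/\<alpha>\<^esup> (log n)\<^bsup>1/2 - 1/\<alpha>\<^esup>\<close>. Some column has norm at most \<open>C\<^sub>0 D\<close>, because a column has no
  entry larger than a suitable multiple of \<open>(n / log n)\<^bsup>1/\<alpha>\<^esup>\<close> with probability at least \<open>n\<^bsup>-1/4\<^esup>\<close>; hence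
  \<open>s\<^sub>m\<^sub>i\<^sub>n \<le> C\<^sub>0 D\<close>. If a unit vector \<open>u\<close> has mass more than \<open>\<delta>\<close> on coordinates of size at most
  \<open>\<surd>(c log n / n)\<close>, its \<open>\<ell>\<^sup>\<alpha>\<close> quasinorm is at least \<open>\<Lambda> D / \<surd>n\<close> with \<open>\<Lambda> \<rightarrow> \<infinity>\<close> as \<open>c \<rightarrow> 0\<close>, and we show that
  no such vector satisfies \<open>\<parallel>X u\<parallel> \<le> C\<^sub>0 D\<close>.

  For a fixed vector \<open>w\<close> with \<open>\<ell>\<^sup>\<alpha>\<close> quasinorm \<open>P D / \<surd>n\<close> the characteristic function of the entries
  decays like \<open>exp (- c \<bar>t\<bar>\<^sup>\<alpha>)\<close> near 0, which gives \<open>\<parallel>X w\<parallel> \<le> (C\<^sub>0 + 1) D\<close> with probability at most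
  \<open>(C / P)\<^sup>N\<close>. Every \<open>u\<close> can be rounded to a point of a grid of mesh
  \<open>\<eta> = (log n)\<^bsup>1/2 - 1/\<alpha>\<^esup> / \<surd>n\<close>, refined according to the column norms, at cost at most \<open>D\<close> in \<open>\<parallel>X u\<parallel>\<close>. The
  number of grid points with \<open>\<ell>\<^sup>\<alpha>\<close> quasinorm at most \<open>P D / \<surd>n\<close> is at most \<open>(C P)\<^sup>n\<close>, so a union bound with
  \<open>N \<ge> a n\<close> beats the entropy of the net once \<open>\<Lambda>\<close> is
  large.\<close>

section \<open>Heavy-tailed laws\<close>

locale heavy_tailed_law = real_distribution \<mu> for \<mu> :: "real measure" +
  fixes \<alpha> C\<^sub>l C\<^sub>u T\<^sub>0 :: real
  assumes alpha_pos: "0 < \<alpha>" and alpha_less: "\<alpha> < 2"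
    and Cl_pos: "C\<^sub>l > 0" and Cu_pos: "C\<^sub>u > 0" and T0_pos: "T\<^sub>0 > 0"
    and heavy: "heavy_tailed \<mu> \<alpha> C\<^sub>l C\<^sub>u T\<^sub>0"
    and symmetric: "symmetrically_distributed \<mu>"
begin

lemma tail_lower: "t \<ge> T\<^sub>0 \<Longrightarrow> C\<^sub>l * t powr (-\<alpha>) \<le> prob {x. \<bar>x\<bar> > t}"
  and tail_upper: "t \<ge> T\<^sub>0 \<Longrightarrow> prob {x. \<bar>x\<bar> > t} \<le> C\<^sub>u * t powr (-\<alpha>)"
  using heavy by (auto simp: heavy_tailed_def)

text \<open>Constants that depend on the law only are passed on as predicates, so that they can be fixed
  before the dimensions and the matrix are.\<close>

definition capped_moment_bound :: "real \<Rightarrow> bool" where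
  "capped_moment_bound C \<longleftrightarrow>
     C > 0 \<and> (\<forall>T\<ge>T\<^sub>0. (\<integral>x. min 1 ((x / T)\<^sup>2) \<partial>\<mu>) \<le> C * T powr (-\<alpha>))"

text \<open>The law has no second moment, so squares are capped at level \<open>T\<close>. Splitting
  at \<open>\<bar>x\<bar> = T\<close> bounds the value at \<open>2 * T\<close> by a quarter of the
  value at \<open>T\<close> plus a tail probability; induction over dyadic ranges of
  \<open>T\<close>, starting from the trivial bound 1, closes the estimate.\<close>

lemma ex_capped_moment_bound: "\<exists>C. capped_moment_bound C"
proof -
  define f where "f T = (\<integral>x. min 1 ((x / T)\<^sup>2) \<partial>\<mu>)" for T
  have int: "integrable \<mu> (\<lambda>x. min 1 ((x / T)\<^sup>2))" for T :: real
    by (rule integrable_const_bound[of _ 1]) auto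
  have f_le_1: "f T \<le> 1" for T
  proof -
    have "f T \<le> (\<integral>x. 1 \<partial>\<mu>)" unfolding f_def by (intro integral_mono int) auto
    then show ?thesis using prob_space by (simp add: space_eq_univ)
  qed
  have doubling: "f (2 * T) \<le> f T / 4 + C\<^sub>u * T powr (-\<alpha>)" if "T \<ge> T\<^sub>0" for T
  proof -
    have T: "T > 0" using that T0_pos by linarith
    have pw: "min 1 ((x / (2 * T))\<^sup>2) \<le> min 1 ((x / T)\<^sup>2) / 4 + indicator {x. \<bar>x\<bar> > T} x" for x :: real
    proof (cases "\<bar>x\<bar> > T")
      case False
      then have "(x / T)\<^sup>2 \<le> 1" using T
        by (simp add: power_divide divide_le_eq abs_le_square_iff[symmetric])
      then show ?thesis using False by (simp add: power_divide power_mult_distrib)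
    qed (auto intro: add_increasing)
    have "f (2 * T) \<le> (\<integral>x. min 1 ((x / T)\<^sup>2) / 4 + indicator {x. \<bar>x\<bar> > T} x \<partial>\<mu>)"
      unfolding f_def using pw by (intro integral_mono int Bochner_Integration.integrable_add)
        (auto intro: int simp: less_top[symmetric])
    also have "\<dots> = f T / 4 + prob {x. \<bar>x\<bar> > T}"
      unfolding f_def by (subst Bochner_Integration.integral_add) (auto intro: int simp: less_top[symmetric])
    finally show ?thesis using tail_upper[OF that] by linarith
  qed
  \<comment> \<open>Since \<open>1/4 < 2\<^bsup>-\<alpha>\<^esup>\<close>, the doubling inequality propagates a bound \<open>C T\<^bsup>-\<alpha>\<^esup>\<close>.\<close>
  have gap: "2 powr (-\<alpha>) - 1/4 > 0"
  proof -
    have "(2::real) powr (-2) < 2 powr (-\<alpha>)" using alpha_less by (intro powr_less_mono) auto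
    moreover have "(2::real) powr (-2) = 1/4" by (simp add: powr_minus powr_numeral)
    ultimately show ?thesis by simp
  qed
  \<comment> \<open>The first argument makes the trivial bound 1 suffice for
    \<open>T \<le> 2 * T\<^sub>0\<close>; the second absorbs the tail term of the doubling
    inequality.\<close>
  define C where "C = max ((2 * T\<^sub>0) powr \<alpha>) (C\<^sub>u / (2 powr (-\<alpha>) - 1/4))"
  have C_pos: "C > 0" using T0_pos by (auto simp: C_def less_max_iff_disj)
  have step: "C / 4 + C\<^sub>u \<le> C * 2 powr (-\<alpha>)"
  proof -
    have "C\<^sub>u / (2 powr (-\<alpha>) - 1/4) \<le> C" by (simp add: C_def)
    then have "C\<^sub>u \<le> C * (2 powr (-\<alpha>) - 1/4)" using gap by (simp add: divide_le_eq)
    then show ?thesis by (simp add: algebra_simps)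
  qed
  have main: "T\<^sub>0 \<le> T \<Longrightarrow> T \<le> 2 ^ Suc k * T\<^sub>0 \<Longrightarrow> f T \<le> C * T powr (-\<alpha>)" for k T
  proof (induction k arbitrary: T)
    case 0
    have T: "T > 0" using 0 T0_pos by linarith
    have "T powr \<alpha> \<le> C" using 0 T alpha_pos
      by (auto simp: C_def le_max_iff_disj intro!: powr_mono2)
    then have "1 \<le> C * T powr (-\<alpha>)" using T by (simp add: powr_minus field_simps)
    then show ?case using f_le_1[of T] by linarith
  next
    case (Suc k)
    have T: "T > 0" using Suc T0_pos by linarith
    show ?case
    proof (cases "T \<le> 2 * T\<^sub>0")
      case True
      have "T powr \<alpha> \<le> C" using True T alpha_pos
        by (auto simp: C_def le_max_iff_disj intro!: powr_mono2)
      then have "1 \<le> C * T powr (-\<alpha>)" using T by (simp add: powr_minus field_simps)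
      then show ?thesis using f_le_1[of T] by linarith
    next
      case False
      have IH: "f (T/2) \<le> C * (T/2) powr (-\<alpha>)" using False Suc by auto
      have "f T \<le> f (T/2) / 4 + C\<^sub>u * (T/2) powr (-\<alpha>)" using doubling[of "T/2"] False by simp
      also have "\<dots> \<le> (C / 4 + C\<^sub>u) * (T/2) powr (-\<alpha>)" using IH by (simp add: algebra_simps)
      also have "\<dots> \<le> C * 2 powr (-\<alpha>) * (T/2) powr (-\<alpha>)" by (intro mult_right_mono step) auto
      also have "\<dots> = C * T powr (-\<alpha>)" using T by (simp add: mult.assoc powr_mult[symmetric])
      finally show ?thesis .
    qed
  qed
  have "f T \<le> C * T powr (-\<alpha>)" if "T \<ge> T\<^sub>0" for T
  proof -
    obtain k where "T / T\<^sub>0 < 2 ^ k" using real_arch_pow[of 2 "T/T\<^sub>0"] by auto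
    then have "T \<le> 2 ^ Suc k * T\<^sub>0"
    proof -
      have "T < 2 ^ k * T\<^sub>0" using \<open>T / T\<^sub>0 < 2 ^ k\<close> T0_pos by (simp add: divide_less_eq)
      also have "\<dots> \<le> 2 ^ Suc k * T\<^sub>0" using T0_pos by simp
      finally show ?thesis by simp
    qed
    then show ?thesis using main that by blast
  qed
  then show ?thesis using C_pos unfolding f_def capped_moment_bound_def by blast
qed

section \<open>The characteristic function near 0\<close>

lemma char_eq_integral_cos: "char \<mu> t = complex_of_real (\<integral>x. cos (t * x) \<partial>\<mu>)"
proof (rule complex_eqI)
  have int: "integrable \<mu> (\<lambda>x. iexp (t * x))" by (rule integrable_iexp) auto
  show "Re (char \<mu> t) = Re (complex_of_real (\<integral>x. cos (t * x) \<partial>\<mu>))"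
    unfolding char_def by (subst integral_Re[OF int, symmetric]) (simp add: Re_exp)
  have "char \<mu> t = char (distr \<mu> borel (\<lambda>x. - x)) t"
    using symmetric by (simp add: symmetrically_distributed_def)
  also have "\<dots> = (CLINT x|\<mu>. cnj (iexp (t * x)))"
    by (simp add: char_def integral_distr exp_cnj)
  also have "\<dots> = cnj (char \<mu> t)" unfolding char_def by (rule Bochner_Integration.integral_cnj)
  finally show "Im (char \<mu> t) = Im (complex_of_real (\<integral>x. cos (t * x) \<partial>\<mu>))"
    by (simp add: complex_eq_iff)
qed

text \<open>By symmetry, 1 minus the characteristic function is the integral of
  \<open>1 - cos (t * x)\<close>, and the mass at distances of order
  \<open>1 / \<bar>t\<bar>\<close> alone makes this at least of order
  \<open>\<bar>t\<bar> powr \<alpha>\<close>.\<close>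

lemma char_decay:
  "\<exists>c>0. \<exists>t\<^sub>0>0. \<forall>t. \<bar>t\<bar> \<le> t\<^sub>0 \<longrightarrow> cmod (char \<mu> t) \<le> exp (- c * \<bar>t\<bar> powr \<alpha>)"
proof -
  have Cl_le: "C\<^sub>l \<le> C\<^sub>u"
  proof -
    have "C\<^sub>l * T\<^sub>0 powr (-\<alpha>) \<le> C\<^sub>u * T\<^sub>0 powr (-\<alpha>)"
      using tail_lower[of T\<^sub>0] tail_upper[of T\<^sub>0] by linarith
    then show ?thesis using T0_pos by (simp add: mult_le_cancel_right)
  qed
  \<comment> \<open>For this \<open>R\<close> the shell \<open>1/(R\<bar>t\<bar>) < \<bar>x\<bar> \<le> 1/\<bar>t\<bar>\<close> has mass at least \<open>C\<^sub>u \<bar>t\<bar>\<^sup>\<alpha>\<close>, and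
     \<open>cos (t x)\<close> is bounded away from 1 on it.\<close>
  define R where "R = (2 * C\<^sub>u / C\<^sub>l) powr (1/\<alpha>)"
  have ratio: "2 * C\<^sub>u / C\<^sub>l > 1" using Cl_le Cl_pos by (simp add: divide_simps)
  have R: "R \<ge> 1" "R powr \<alpha> = 2 * C\<^sub>u / C\<^sub>l" using ratio alpha_pos
Cl_pos Cu_pos
    by (auto simp: R_def powr_powr intro!: ge_one_powr_ge_zero)
  define \<kappa> where "\<kappa> = 1 - cos (1/R)"
  have kappa: "\<kappa> > 0"
  proof -
    have "1 / R \<le> 1" using R(1) by simp
    then have "1 / R \<le> pi" using pi_gt3 by linarith
    then have "cos (1/R) < cos 0" using R(1) by (intro cos_monotone_0_pi) auto
    then show ?thesis by (simp add: \<kappa>_def)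
  qed
  \<comment> \<open>Continuity makes the real-valued characteristic function positive near 0, so an
    upper bound on its value is a bound on its modulus.\<close>
  have "\<forall>e>0. \<exists>d>0. \<forall>t. \<bar>t\<bar> < d \<longrightarrow> dist (char \<mu> t) (char \<mu> 0) < e"
    using isCont_char[of 0] unfolding continuous_at_eps_delta by (simp add: dist_real_def)
  then obtain t\<^sub>1 where t\<^sub>1: "t\<^sub>1 > 0" "\<And>t. \<bar>t\<bar> < t\<^sub>1 \<Longrightarrow> dist (char \<mu> t) (char \<mu> 0) < 1"
    using zero_less_one by blast
  \<comment> \<open>The second argument gives
    \<open>1 / (R * \<bar>t\<bar>) \<ge> T\<^sub>0\<close>, so the tail bounds apply at both radii
    of the shell.\<close>
  define t\<^sub>0 where "t\<^sub>0 = min (t\<^sub>1/2) (1 / (R * T\<^sub>0))"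
  have "t\<^sub>0 > 0" using t\<^sub>1 R(1) T0_pos by (auto simp: t\<^sub>0_def)
  moreover have "cmod (char \<mu> t) \<le> exp (- (\<kappa> * C\<^sub>u) * \<bar>t\<bar> powr \<alpha>)" if t: "\<bar>t\<bar> \<le> t\<^sub>0" for t
  proof (cases "t = 0")
    case True then show ?thesis by (simp add: char_zero)
  next
    case False
    define s where "s = \<bar>t\<bar>"
    have s: "s > 0" "s \<le> t\<^sub>0" using False t by (auto simp: s_def)
    define r where "r = (\<integral>x. cos (t * x) \<partial>\<mu>)"
    have "dist (char \<mu> t) (char \<mu> 0) < 1" using t\<^sub>1 s by (intro t\<^sub>1) (auto simp: s_def t\<^sub>0_def)
    then have "cmod (complex_of_real (r - 1)) < 1"
      unfolding char_zero dist_norm char_eq_integral_cos[of t] r_def by simp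
    then have r_pos: "r > 0" unfolding norm_of_real by linarith
    have intc: "integrable \<mu> (\<lambda>x. cos (t * x))" by (rule integrable_const_bound[of _ 1]) auto
    have lowT: "1 / (R * s) \<ge> T\<^sub>0"
    proof -
      have "s \<le> 1 / (R * T\<^sub>0)" using s by (auto simp: t\<^sub>0_def)
      then show ?thesis using s R(1) T0_pos by (simp add: field_simps)
    qed
    have le: "1 / (R * s) \<le> 1 / s" using R(1) s by (simp add: divide_simps)
    define A where "A = {x::real. \<bar>x\<bar> > 1 / (R * s)} - {x. \<bar>x\<bar> > 1 / s}"
    have [measurable]: "A \<in> sets borel" unfolding A_def by measurable
    have pA: "prob A = prob {x. \<bar>x\<bar> > 1 / (R * s)} - prob {x. \<bar>x\<bar> > 1 / s}"
      unfolding A_def using le by (intro finite_measure_Diff) auto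
    have pw: "cos (t * x) + \<kappa> * indicator A x \<le> 1" for x
    proof (cases "x \<in> A")
      case True
      then have x: "\<bar>x\<bar> > 1 / (R * s)" "\<bar>x\<bar> \<le> 1 / s" by (auto simp: A_def)
      have "s * \<bar>x\<bar> \<ge> 1 / R" "s * \<bar>x\<bar> \<le> 1" using x s R(1) by (auto simp: field_simps)
      then have "cos (s * \<bar>x\<bar>) \<le> cos (1/R)" using R(1) pi_gt3
        by (intro cos_monotone_0_pi_le) auto
      moreover have "cos (t * x) = cos (s * \<bar>x\<bar>)" 
        unfolding s_def abs_mult[symmetric] by (metis cos_abs_real)
      ultimately show ?thesis using True by (simp add: \<kappa>_def)
    qed auto
    have "r + \<kappa> * prob A = (\<integral>x. cos (t * x) + \<kappa> * indicator A x \<partial>\<mu>)"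
      unfolding r_def by (subst Bochner_Integration.integral_add) (auto intro: intc simp: less_top[symmetric])
    also have "\<dots> \<le> (\<integral>x. 1 \<partial>\<mu>)"
      by (intro integral_mono Bochner_Integration.integrable_add intc pw) (auto simp: less_top[symmetric])
    finally have r_le: "r + \<kappa> * prob A \<le> 1" using prob_space by (simp add: space_eq_univ)
    have "C\<^sub>u * s powr \<alpha> = C\<^sub>l * (1 / (R * s)) powr (-\<alpha>) - C\<^sub>u * (1 / s) powr (-\<alpha>)"
      using s R Cl_pos by (simp add: powr_minus powr_divide powr_mult field_simps)
    also have "\<dots> \<le> prob A" unfolding pA
      using tail_lower[OF lowT] tail_upper[of "1/s"] lowT le by linarith
    finally have "\<kappa> * (C\<^sub>u * s powr \<alpha>) \<le> \<kappa> * prob A" using kappa by simp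
    then have "r \<le> 1 + (- (\<kappa> * C\<^sub>u) * s powr \<alpha>)" using r_le by simp
    also have "\<dots> \<le> exp (- (\<kappa> * C\<^sub>u) * s powr \<alpha>)" by (rule exp_ge_add_one_self)
    finally show ?thesis using r_pos by (simp add: char_eq_integral_cos r_def s_def)
  qed
  moreover have "\<kappa> * C\<^sub>u > 0" using kappa Cu_pos by simp
  ultimately show ?thesis by blast
qed

end

section \<open>Decay of Gaussian averages of characteristic functions\<close>

text \<open>The Gaussian \<open>exp (- (s * z)\<^sup>2 / 2)\<close> is the average of
  \<open>iexp (s * z * g)\<close> over a standard normal \<open>g\<close>, and Fubini moves that
  average outside. This Esseen-type inequality turns decay of characteristic functions into
  small-ball bounds.\<close>

lemma integral_gaussian_le_integral_char:
  assumes "real_distribution \<nu>"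
  shows "(\<integral>z. exp (- (s * z)\<^sup>2 / 2) \<partial>\<nu>) \<le> (\<integral>g. cmod (char \<nu> (s * g)) \<partial>std_normal_distribution)"
proof -
  interpret \<nu>: real_distribution \<nu> by fact
  let ?N = std_normal_distribution
  interpret N: real_distribution ?N by (rule real_dist_normal_dist)
  interpret P: pair_prob_space \<nu> ?N ..
  have int: "integrable (\<nu> \<Otimes>\<^sub>M ?N) (\<lambda>(z, g). iexp ((s * z) * g))"
  proof (rule P.integrable_const_bound[of _ 1])
    show "(\<lambda>(z, g). iexp ((s * z) * g)) \<in> borel_measurable (\<nu> \<Otimes>\<^sub>M ?N)"
    proof -
      have "(\<lambda>p. iexp ((s * fst p) * snd p)) \<in> borel_measurable (borel \<Otimes>\<^sub>M borel)" by measurable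
      moreover have "sets (\<nu> \<Otimes>\<^sub>M ?N) = sets (borel \<Otimes>\<^sub>M borel)"
        by (intro sets_pair_measure_cong) auto
      ultimately show ?thesis by (simp add: case_prod_unfold cong: measurable_cong_sets)
    qed
  qed auto
  have "complex_of_real (\<integral>z. exp (- (s * z)\<^sup>2 / 2) \<partial>\<nu>) = (CLINT z|\<nu>. char ?N (s * z))"
    unfolding char_std_normal_distribution by (simp add: integral_complex_of_real)
  also have "\<dots> = (CLINT z|\<nu>. CLINT g|?N. iexp ((s * z) * g))" unfolding char_def ..
  also have "\<dots> = (CLINT g|?N. CLINT z|\<nu>. iexp ((s * z) * g))"
    by (rule P.Fubini_integral[OF int, symmetric])
  also have "\<dots> = (CLINT g|?N. char \<nu> (s * g))"
    unfolding char_def by (simp add: mult_ac)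
  finally have eq: "complex_of_real (\<integral>z. exp (- (s * z)\<^sup>2 / 2) \<partial>\<nu>) = (CLINT g|?N. char \<nu> (s * g))" .
  have "(\<integral>z. exp (- (s * z)\<^sup>2 / 2) \<partial>\<nu>) \<le> cmod (complex_of_real (\<integral>z. exp (- (s * z)\<^sup>2 / 2) \<partial>\<nu>))"
    unfolding norm_of_real by linarith
  also have "\<dots> \<le> (\<integral>g. cmod (char \<nu> (s * g)) \<partial>?N)"
    unfolding eq by (rule integral_norm_bound)
  finally show ?thesis .
qed

lemma cauchy_integral_scaled:
  assumes "P > 0"
  shows "integrable lborel (\<lambda>x. inverse (1 + (P * x)\<^sup>2))"
    and "(\<integral>x. inverse (1 + (P * x)\<^sup>2) \<partial>lborel) = pi / P"
proof -
  have 1: "integrable lborel (\<lambda>x::real. inverse (1 + x\<^sup>2))"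
    using integrable_inverse_1_plus_square by (simp add: set_integrable_def)
  have 2: "(\<integral>x. inverse (1 + x\<^sup>2) \<partial>lborel) = pi"
    using LBINT_inverse_1_plus_square
    by (simp add: interval_lebesgue_integral_def set_lebesgue_integral_def)
  show "integrable lborel (\<lambda>x. inverse (1 + (P * x)\<^sup>2))"
    using lborel_integrable_real_affine[OF 1, of P 0] assms by simp
  show "(\<integral>x. inverse (1 + (P * x)\<^sup>2) \<partial>lborel) = pi / P"
  proof -
    have "pi = \<bar>P\<bar> *\<^sub>R (\<integral>x. inverse (1 + (0 + P * x)\<^sup>2) \<partial>lborel)"
      unfolding 2[symmetric] using assms by (intro lborel_integral_real_affine) auto
    then have "pi = P * (\<integral>x. inverse (1 + (P * x)\<^sup>2) \<partial>lborel)"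
      using assms by (simp only: add_0 abs_of_pos real_scaleR_def)
    then show ?thesis using assms by (metis less_irrefl nonzero_mult_div_cancel_left)
  qed
qed

text \<open>Supplies an integrable majorant; with \<open>y = P * g\<close> the Cauchy integral then
  produces the factor \<open>1 / P\<close>.\<close>

lemma stretched_exp_le_cauchy:
  assumes "c > 0" "\<alpha> > 0"
  shows "\<exists>C>0. \<forall>y::real. exp (- c * \<bar>y\<bar> powr \<alpha>) \<le> C * inverse (1 + y\<^sup>2)"
proof -
  \<comment> \<open>With \<open>z = \<bar>y\<bar> powr \<alpha>\<close>, an integer
    \<open>k \<ge> 2 / \<alpha>\<close> gives \<open>y\<^sup>2 \<le> 1 + z ^ k\<close>, and
    \<open>z ^ k\<close> is controlled by one term of the exponential series of
    \<open>c * z\<close>.\<close>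
  define k where "k = nat \<lceil>2 / \<alpha>\<rceil>"
  have k: "2 / \<alpha> \<le> real k" by (simp add: k_def of_nat_ceiling)
  define C where "C = 2 + fact k / c ^ k"
  have "C > 0" using assms by (auto simp: C_def intro!: add_pos_nonneg)
  moreover have "exp (- c * \<bar>y\<bar> powr \<alpha>) \<le> C * inverse (1 + y\<^sup>2)" for y :: real
  proof -
    define z where "z = \<bar>y\<bar> powr \<alpha>"
    have z: "z \<ge> 0" by (simp add: z_def)
    have y2: "y\<^sup>2 = z powr (2 / \<alpha>)"
      using assms by (cases "y = 0") (auto simp: z_def powr_powr powr_numeral)
    have "z powr (2 / \<alpha>) \<le> 1 + z ^ k"
    proof (cases "z \<le> 1")
      case True
      have "z powr (2 / \<alpha>) \<le> 1" using True z assms by (intro powr_le1) auto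
      then show ?thesis using z by (simp add: add_increasing2)
    next
      case False
      have "z powr (2 / \<alpha>) \<le> z powr real k" using False k by (intro powr_mono) auto
      also have "\<dots> = z ^ k" using False by (simp add: powr_realpow)
      finally show ?thesis by simp
    qed
    moreover have "(c * z) ^ k / fact k \<le> exp (c * z)"
    proof -
      have "0 \<le> c * z" using z assms by simp
      then have "(\<Sum>n<Suc k. (c * z) ^ n /\<^sub>R fact n) \<le> exp (c * z)"
        unfolding exp_def by (intro sum_le_suminf summable_exp_generic) auto
      moreover have "(\<Sum>n<k. (c * z) ^ n /\<^sub>R fact n) \<ge> 0"
        using \<open>0 \<le> c * z\<close> by (intro sum_nonneg) auto
      moreover have "(c * z) ^ k / fact k = (c * z) ^ k /\<^sub>R fact k"
        unfolding divide_inverse real_scaleR_def by (rule mult.commute)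
      ultimately have "(c * z) ^ k / fact k \<le> exp (c * z)" by simp
      then show ?thesis .
    qed
    then have "z ^ k \<le> fact k / c ^ k * exp (c * z)"
      using assms by (simp add: power_mult_distrib field_simps)
    moreover have "1 \<le> exp (c * z)" using z assms by simp
    ultimately have "1 + y\<^sup>2 \<le> C * exp (c * z)"
      unfolding y2 C_def ring_distribs by linarith
    then have "exp (- (c * z)) * (1 + y\<^sup>2) \<le> C"
      by (simp add: exp_minus field_simps)
    then show ?thesis
      unfolding z_def[symmetric] by (simp add: divide_inverse[symmetric] pos_le_divide_eq add_pos_nonneg)
  qed
  ultimately show ?thesis by blast
qed

context heavy_tailed_law
begin

text \<open>Here \<open>1 / s\<close> is the small-ball scale per row and \<open>P\<close> a lower
  bound for the quasinorm of \<open>s * u\<close> with exponent \<open>\<alpha>\<close>. The cap on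
  \<open>P\<^sup>2\<close> makes the Gaussian weight small compared with
  \<open>1 / P\<^sup>2\<close> where the arguments leave the range in which the decay of
  \<open>char \<mu>\<close> is known.\<close>

definition char_prod_bound :: "real \<Rightarrow> real \<Rightarrow> bool" where
  "char_prod_bound C \<kappa> \<longleftrightarrow> C > 0 \<and> \<kappa> > 0 \<and> (\<forall>(J::nat set) u s P.
     finite J \<and> s > 0 \<and> P > 0 \<and> (\<forall>j\<in>J. \<bar>u j\<bar> \<le> 2) \<and>
     P powr \<alpha> \<le> (\<Sum>j\<in>J. \<bar>s * u j\<bar> powr \<alpha>) \<and> P\<^sup>2 \<le> exp (\<kappa> / s\<^sup>2) \<longrightarrow>
     (\<integral>g. (\<Prod>j\<in>J. cmod (char \<mu> (s * g * u j))) \<partial>std_normal_distribution) \<le> C / P)"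

lemma ex_char_prod_bound: "\<exists>C \<kappa>. char_prod_bound C \<kappa>"
proof -
  obtain c t\<^sub>0 where c: "c > 0" "t\<^sub>0 > 0"
    and decay: "\<And>t. \<bar>t\<bar> \<le> t\<^sub>0 \<Longrightarrow> cmod (char \<mu> t) \<le> exp (- c * \<bar>t\<bar> powr \<alpha>)"
    using char_decay by blast
  obtain C1 where C1: "C1 > 0" "\<And>y::real. exp (- c * \<bar>y\<bar> powr \<alpha>) \<le> C1 * inverse (1 + y\<^sup>2)"
    using stretched_exp_le_cauchy[OF c(1) alpha_pos] by blast
  \<comment> \<open>Chosen so that
    \<open>exp (- g\<^sup>2 / 4) \<le> exp (- \<kappa> / s\<^sup>2)\<close> once
    \<open>\<bar>g\<bar> \<ge> t\<^sub>0 / (2 * s)\<close>.\<close>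
  define \<kappa> where "\<kappa> = t\<^sub>0\<^sup>2 / 16"
  define C where "C = C1 + 5"
  have "(\<integral>g. (\<Prod>j\<in>J. cmod (char \<mu> (s * g * u j))) \<partial>std_normal_distribution) \<le> C * pi / P"
    if J: "finite (J::nat set)" and s: "s > 0" and P: "P > 0" and u: "\<And>j. j \<in> J \<Longrightarrow> \<bar>u j\<bar> \<le> 2"
      and Pa: "P powr \<alpha> \<le> (\<Sum>j\<in>J. \<bar>s * u j\<bar> powr \<alpha>)" and P2: "P\<^sup>2 \<le> exp (\<kappa> / s\<^sup>2)" for J u s P
  proof -
    define h where "h g = (\<Prod>j\<in>J. cmod (char \<mu> (s * g * u j)))" for g
    have h_meas[measurable]: "h \<in> borel_measurable borel" unfolding h_def by measurable
    have h1: "0 \<le> h g" "h g \<le> 1" for g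
      unfolding h_def by (auto intro!: prod_nonneg prod_le_1 cmod_char_le_1)
    have dens_le: "std_normal_density g \<le> exp (- g\<^sup>2 / 2)" for g
    proof -
      have "1 \<le> sqrt (2 * pi)" using pi_gt3 by simp
      then show ?thesis by (simp add: normal_density_def divide_simps)
    qed
    \<comment> \<open>In the central range all arguments \<open>s * g * u j\<close> have modulus at
      most \<open>t\<^sub>0\<close>, so the decay estimates multiply to at most
      \<open>exp (- c * \<bar>P * g\<bar> powr \<alpha>)\<close>. Beyond it \<open>h\<close> is
      bounded by 1 and the normal density alone suffices.\<close>
    have pw: "std_normal_density g * h g \<le> C * inverse (1 + (P * g)\<^sup>2)" for g
    proof (cases "\<bar>g\<bar> \<le> t\<^sub>0 / (2 * s)")
      case True
      have "h g \<le> (\<Prod>j\<in>J. exp (- c * \<bar>s * g * u j\<bar> powr \<alpha>))"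
        unfolding h_def
      proof (intro prod_mono conjI decay)
        fix j assume "j \<in> J"
        have "\<bar>s * g * u j\<bar> = s * \<bar>g\<bar> * \<bar>u j\<bar>" using s by (simp add: abs_mult)
        also have "\<dots> \<le> s * (t\<^sub>0 / (2 * s)) * 2" using True u[OF \<open>j \<in> J\<close>] s c
          by (intro mult_mono) auto
        also have "\<dots> = t\<^sub>0" using s by simp
        finally show "\<bar>s * g * u j\<bar> \<le> t\<^sub>0" .
      qed auto
      also have "\<dots> = exp (- c * (\<bar>g\<bar> powr \<alpha> * (\<Sum>j\<in>J. \<bar>s * u j\<bar> powr \<alpha>)))"
        unfolding exp_sum[OF J, symmetric] sum_distrib_left
        by (intro arg_cong[where f = exp] sum.cong) (simp_all add: abs_mult powr_mult mult_ac)
      also have "\<dots> \<le> exp (- c * (\<bar>g\<bar> powr \<alpha> * P powr \<alpha>))"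
        using c Pa by (simp add: mult_left_mono)
      also have "\<dots> = exp (- c * \<bar>P * g\<bar> powr \<alpha>)" using P by (simp add: abs_mult powr_mult mult_ac)
      also have "\<dots> \<le> C1 * inverse (1 + (P * g)\<^sup>2)" by (rule C1)
      finally have "h g \<le> C1 * inverse (1 + (P * g)\<^sup>2)" .
      moreover have "std_normal_density g \<le> 1" by (rule order.trans[OF dens_le]) simp
      ultimately have "std_normal_density g * h g \<le> 1 * (C1 * inverse (1 + (P * g)\<^sup>2))"
        using h1 by (intro mult_mono) auto
      also have "\<dots> \<le> C * inverse (1 + (P * g)\<^sup>2)"
        unfolding mult_1 by (intro mult_right_mono) (auto simp: C_def)
      finally show ?thesis .
    next
      case False
      define G where "G = t\<^sub>0 / (2 * s)"
      have G: "0 < G" "G \<le> \<bar>g\<bar>" using False s c by (auto simp: G_def)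
      have "G\<^sup>2 \<le> g\<^sup>2" using power_mono[of G "\<bar>g\<bar>" 2] G by simp
      then have "exp (- g\<^sup>2 / 4) \<le> exp (- G\<^sup>2 / 4)" by simp
      also have "\<dots> = inverse (exp (\<kappa> / s\<^sup>2))"
        by (simp add: G_def \<kappa>_def exp_minus[symmetric] power_divide power_mult_distrib)
      finally have "P\<^sup>2 * exp (- g\<^sup>2 / 4) \<le> exp (\<kappa> / s\<^sup>2) * inverse (exp (\<kappa> / s\<^sup>2))"
        using P2 by (intro mult_mono) auto
      then have A: "P\<^sup>2 * exp (- g\<^sup>2 / 4) \<le> 1" by simp
      have B: "g\<^sup>2 * exp (- g\<^sup>2 / 4) \<le> 4"
      proof -
        have "g\<^sup>2 / 4 \<le> exp (g\<^sup>2 / 4)" using exp_ge_add_one_self[of "g\<^sup>2/4"] by linarith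
        then show ?thesis by (simp add: exp_minus field_simps)
      qed
      \<comment> \<open>The Gaussian is split into two equal factors, one absorbing
        \<open>P\<^sup>2\<close> and the other \<open>g\<^sup>2\<close>; hence the 5 in
        \<open>C\<close>.\<close>
      have "(1 + (P * g)\<^sup>2) * exp (- g\<^sup>2 / 2)
          = exp (- g\<^sup>2 / 2) + (P\<^sup>2 * exp (- g\<^sup>2 / 4)) * (g\<^sup>2 * exp (- g\<^sup>2 / 4))"
      proof -
        have "exp (- g\<^sup>2 / 2) = exp (- g\<^sup>2 / 4) * exp (- g\<^sup>2 / 4)"
          unfolding exp_add[symmetric] by (rule arg_cong[where f = exp]) simp
        then show ?thesis by (simp add: algebra_simps power_mult_distrib)
      qed
      also have "\<dots> \<le> 1 + 1 * 4" using A B by (intro add_mono mult_mono) auto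
      finally have "exp (- g\<^sup>2 / 2) \<le> 5 * inverse (1 + (P * g)\<^sup>2)"
        by (simp add: divide_inverse[symmetric] pos_le_divide_eq add_pos_nonneg mult.commute)
      also have "\<dots> \<le> C * inverse (1 + (P * g)\<^sup>2)"
        using C1(1) by (intro mult_right_mono) (auto simp: C_def)
      finally have "std_normal_density g \<le> C * inverse (1 + (P * g)\<^sup>2)" using dens_le order.trans by blast
      moreover have "std_normal_density g * h g \<le> std_normal_density g * 1"
        using h1 by (intro mult_left_mono) auto
      ultimately show ?thesis by simp
    qed
    have "(\<integral>g. h g \<partial>std_normal_distribution) = (\<integral>g. std_normal_density g * h g \<partial>lborel)"
      by (subst integral_density) auto
    also have "\<dots> \<le> (\<integral>g. C * inverse (1 + (P * g)\<^sup>2) \<partial>lborel)"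
    proof (rule integral_mono)
      show int: "integrable lborel (\<lambda>g. C * inverse (1 + (P * g)\<^sup>2))"
        by (intro integrable_mult_right cauchy_integral_scaled P)
      show "integrable lborel (\<lambda>g. std_normal_density g * h g)"
      proof (rule Bochner_Integration.integrable_bound[OF int])
        have "norm (std_normal_density g * h g) \<le> norm (C * inverse (1 + (P * g)\<^sup>2))" for g
        proof -
          have "norm (std_normal_density g * h g) = std_normal_density g * h g"
            using h1 by (simp add: abs_mult)
          then show ?thesis using pw[of g] by simp
        qed
        then show "AE g in lborel. norm (std_normal_density g * h g) \<le> norm (C * inverse (1 + (P * g)\<^sup>2))"
          by (rule AE_I2)
      qed measurable
    qed (rule pw)
    also have "\<dots> = C * pi / P" using cauchy_integral_scaled(2)[OF P] by simp
    finally show ?thesis by (simp add: h_def)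
  qed
  note bound = this
  have "\<kappa> > 0" "C * pi > 0" using c C1(1) by (auto simp: \<kappa>_def C_def)
  then show ?thesis unfolding char_prod_bound_def
    by (intro exI[of _ "C * pi"] exI[of _ \<kappa>] conjI allI impI bound) auto
qed

end

section \<open>Rows and columns of the random matrix\<close>

locale heavy_tailed_matrix = heavy_tailed_law \<mu> \<alpha> C\<^sub>l C\<^sub>u T\<^sub>0 + M: prob_space M
  for \<mu> \<alpha> C\<^sub>l C\<^sub>u T\<^sub>0 and M :: "'w measure" +
  fixes N n :: nat and X :: "'w \<Rightarrow> nat \<Rightarrow> nat \<Rightarrow> real"
  assumes iid: "iid_matrix M \<mu> N n X"
begin

lemma entry_measurable [measurable]:
  "i \<in> {1..N} \<Longrightarrow> j \<in> {1..n} \<Longrightarrow> (\<lambda>\<omega>. X \<omega> i j) \<in> borel_measurable M"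
  using iid unfolding iid_matrix_def M.indep_vars_def by force

lemma entry_distr: "i \<in> {1..N} \<Longrightarrow> j \<in> {1..n} \<Longrightarrow> distr M borel (\<lambda>\<omega>. X \<omega> i j) = \<mu>"
  using iid by (auto simp: iid_matrix_def)

lemma entry_integral:
  fixes f :: "real \<Rightarrow> real"
  assumes "i \<in> {1..N}" "j \<in> {1..n}" "f \<in> borel_measurable borel"
  shows "(\<integral>\<omega>. f (X \<omega> i j) \<partial>M) = (\<integral>x. f x \<partial>\<mu>)"
  unfolding entry_distr[OF assms(1,2), symmetric]
  using assms by (subst integral_distr) auto

text \<open>Applied to blocks that are single entries, whole rows or whole columns, so that each
  independence claim reduces to disjointness of the blocks.\<close>

lemma indep_blocks:
  fixes Z :: "'l \<Rightarrow> 'w \<Rightarrow> real"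
  assumes "\<And>l. l \<in> L \<Longrightarrow> K l \<subseteq> {1..N} \<times> {1..n}" "disjoint_family_on K L"
    and Y: "\<And>l. l \<in> L \<Longrightarrow> Y l \<in> borel_measurable (PiM (K l) (\<lambda>_. borel))"
    and Z: "\<And>l \<omega>. l \<in> L \<Longrightarrow> Z l \<omega> = Y l (restrict (\<lambda>(i, j). X \<omega> i j) (K l))"
  shows "M.indep_vars (\<lambda>_. borel) Z L"
proof -
  have "M.indep_vars (\<lambda>_. borel) (\<lambda>(i, j) \<omega>. X \<omega> i j) ({1..N} \<times> {1..n})"
    using iid by (simp add: iid_matrix_def)
  from M.indep_vars_restrict[OF this assms(1,2)]
  have "M.indep_vars (\<lambda>l. PiM (K l) (\<lambda>_. borel)) (\<lambda>l \<omega>. restrict (\<lambda>(i, j). X \<omega> i j) (K l)) L"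
    by (simp add: case_prod_unfold)
  from M.indep_vars_compose2[OF this, of Y "\<lambda>_. borel"] Y
  have "M.indep_vars (\<lambda>_. borel) (\<lambda>l \<omega>. Y l (restrict (\<lambda>(i, j). X \<omega> i j) (K l))) L" by simp
  then show ?thesis
    by (subst M.indep_vars_cong[OF refl _ refl]) (use Z in auto)
qed

text \<open>An exponential Markov inequality: with \<open>s = 1 / \<tau>\<close>, on the event the
  product over the rows of \<open>exp (- (s * Z i \<omega>)\<^sup>2 / 2)\<close> is at least
  \<open>exp (- N / 2)\<close>, hence at least \<open>(1 / 2) ^ N\<close>. The rows are independent,
  so its expectation factorizes, and each factor is at most \<open>C / P\<close> by the Fourier
  bound.\<close>

lemma small_ball:
  assumes C: "char_prod_bound C \<kappa>" and \<tau>: "\<tau> > 0" and P: "P > 0"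
    and u: "\<And>j. j \<in> {1..n} \<Longrightarrow> \<bar>u j\<bar> \<le> 2"
    and Pa: "(P * \<tau>) powr \<alpha> \<le> (\<Sum>j\<in>{1..n}. \<bar>u j\<bar> powr \<alpha>)" and P2: "P\<^sup>2 \<le> exp (\<kappa> * \<tau>\<^sup>2)"
  shows "M.prob {\<omega>\<in>space M. (\<Sum>i\<in>{1..N}. (mat_vec n (X \<omega>) u i)\<^sup>2) \<le> real N * \<tau>\<^sup>2} \<le> (2 * C / P) ^ N"
proof -
  define s where "s = 1 / \<tau>"
  have s: "s > 0" using \<tau> by (simp add: s_def)
  define Z where "Z i \<omega> = mat_vec n (X \<omega>) u i" for i \<omega>
  have Z_meas[measurable]: "Z i \<in> borel_measurable M" if "i \<in> {1..N}" for i
    using that unfolding Z_def mat_vec_def by measurable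
  have row: "(\<integral>\<omega>. exp (- (s * Z i \<omega>)\<^sup>2 / 2) \<partial>M) \<le> C / P" if i: "i \<in> {1..N}" for i
  proof -
    have ind: "M.indep_vars (\<lambda>_. borel) (\<lambda>j \<omega>. X \<omega> i j * u j) {1..n}"
    proof (rule indep_blocks)
      show "\<And>j. j \<in> {1..n} \<Longrightarrow> {(i, j)} \<subseteq> {1..N} \<times> {1..n}" using i by auto
      show "disjoint_family_on (\<lambda>j. {(i, j)}) {1..n}" by (auto simp: disjoint_family_on_def)
      show "(\<lambda>f. f (i, j) * u j) \<in> borel_measurable (PiM {(i, j)} (\<lambda>_. borel))" for j
        by measurable
    qed auto
    have dist: "distr M borel (Z i) = distr M borel (\<lambda>\<omega>. \<Sum>j\<in>{1..n}. X \<omega> i j * u j)"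
      by (intro distr_cong refl) (simp add: Z_def mat_vec_def)
    have rd: "real_distribution (distr M borel (Z i))" using i by (intro M.real_distribution_distr) auto
    have ch: "char (distr M borel (\<lambda>\<omega>. X \<omega> i j * u j)) t = char \<mu> (t * u j)" if "j \<in> {1..n}" for j t
      unfolding entry_distr[OF i that, symmetric] char_def
      using i that by (simp add: integral_distr mult_ac)
    have "(\<integral>\<omega>. exp (- (s * Z i \<omega>)\<^sup>2 / 2) \<partial>M) = (\<integral>z. exp (- (s * z)\<^sup>2 / 2) \<partial>distr M borel (Z i))"
      using i by (subst integral_distr) auto
    also have "\<dots> \<le> (\<integral>g. cmod (char (distr M borel (Z i)) (s * g)) \<partial>std_normal_distribution)"
      by (rule integral_gaussian_le_integral_char[OF rd])
    also have "\<dots> = (\<integral>g. (\<Prod>j\<in>{1..n}. cmod (char \<mu> (s * g * u j))) \<partial>std_normal_distribution)"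
      unfolding dist M.char_distr_sum[OF ind] prod_norm[symmetric]
      by (intro Bochner_Integration.integral_cong refl prod.cong) (simp add: ch)
    also have "\<dots> \<le> C / P"
    proof -
      have "P powr \<alpha> = (s * (P * \<tau>)) powr \<alpha>" using \<tau> by (simp add: s_def)
      also have "\<dots> = s powr \<alpha> * (P * \<tau>) powr \<alpha>" using s P \<tau> by (simp add: powr_mult)
      also have "\<dots> \<le> s powr \<alpha> * (\<Sum>j\<in>{1..n}. \<bar>u j\<bar> powr \<alpha>)" using Pa by (intro mult_left_mono) auto
      also have "\<dots> = (\<Sum>j\<in>{1..n}. \<bar>s * u j\<bar> powr \<alpha>)"
        using s by (simp add: sum_distrib_left abs_mult powr_mult)
      finally have "P powr \<alpha> \<le> (\<Sum>j\<in>{1..n}. \<bar>s * u j\<bar> powr \<alpha>)" .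
      moreover have "P\<^sup>2 \<le> exp (\<kappa> / s\<^sup>2)" using P2 by (simp add: s_def power_divide)
      ultimately show ?thesis using C s P u unfolding char_prod_bound_def by auto
    qed
    finally show ?thesis .
  qed
  have indZ: "M.indep_vars (\<lambda>_. borel) (\<lambda>i \<omega>. exp (- (s * Z i \<omega>)\<^sup>2 / 2)) {1..N}"
  proof (rule indep_blocks)
    show "\<And>i. i \<in> {1..N} \<Longrightarrow> {i} \<times> {1..n} \<subseteq> {1..N} \<times> {1..n}" by auto
    show "disjoint_family_on (\<lambda>i. {i} \<times> {1..n}) {1..N}" by (auto simp: disjoint_family_on_def)
    show "(\<lambda>f. exp (- (s * (\<Sum>j\<in>{1..n}. f (i, j) * u j))\<^sup>2 / 2))
        \<in> borel_measurable (PiM ({i} \<times> {1..n}) (\<lambda>_. borel))" for i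
    proof -
      have [measurable]: "(\<lambda>f. f (i, j)) \<in> borel_measurable (PiM ({i} \<times> {1..n}) (\<lambda>_. borel))"
        if "j \<in> {1..n}" for j using that by (intro measurable_component_singleton) auto
      show ?thesis by measurable
    qed
    show "exp (- (s * Z i \<omega>)\<^sup>2 / 2) = exp (- (s * (\<Sum>j\<in>{1..n}. 
      restrict (\<lambda>(i, j). X \<omega> i j) ({i} \<times> {1..n}) (i, j) * u j))\<^sup>2 / 2)" for i \<omega>
      by (simp add: Z_def mat_vec_def)
  qed
  have intZ: "integrable M (\<lambda>\<omega>. exp (- (s * Z i \<omega>)\<^sup>2 / 2))" if "i \<in> {1..N}" for i
    using that by (intro M.integrable_const_bound[of _ 1]) auto
  let ?A = "{\<omega>\<in>space M. (\<Sum>i\<in>{1..N}. (mat_vec n (X \<omega>) u i)\<^sup>2) \<le> real N * \<tau>\<^sup>2}"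
  have A_eq: "?A = {\<omega>\<in>space M. (\<Sum>i\<in>{1..N}. (Z i \<omega>)\<^sup>2) \<le> real N * \<tau>\<^sup>2}" by (simp add: Z_def)
  have A_meas: "?A \<in> sets M" unfolding A_eq by measurable
  have pw: "indicator ?A \<omega> \<le> 2 ^ N * (\<Prod>i\<in>{1..N}. exp (- (s * Z i \<omega>)\<^sup>2 / 2))" for \<omega>
  proof (cases "\<omega> \<in> ?A")
    case True
    have "(\<Sum>i\<in>{1..N}. (s * Z i \<omega>)\<^sup>2) = s\<^sup>2 * (\<Sum>i\<in>{1..N}. (Z i \<omega>)\<^sup>2)"
      by (simp add: power_mult_distrib sum_distrib_left)
    also have "\<dots> \<le> s\<^sup>2 * (real N * \<tau>\<^sup>2)" using True unfolding A_eq by (intro mult_left_mono) auto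
    also have "\<dots> = real N" using \<tau> by (simp add: s_def power_divide)
    finally have le: "(\<Sum>i\<in>{1..N}. (s * Z i \<omega>)\<^sup>2) \<le> real N" .
    have "exp (1/2 :: real) \<le> 2"
    proof -
      have "exp (1/2 :: real) ^ 2 = exp 1" by (simp add: exp_of_nat_mult[symmetric])
      also have "\<dots> \<le> 2 ^ 2" using exp_le by simp
      finally show ?thesis by (rule power2_le_imp_le) simp
    qed
    then have "exp (1/2) ^ N \<le> (2::real) ^ N" by (intro power_mono) auto
    then have "exp (real N / 2) \<le> (2::real) ^ N" by (simp add: exp_of_nat_mult[symmetric])
    moreover have "(\<Prod>i\<in>{1..N}. exp (- (s * Z i \<omega>)\<^sup>2 / 2)) = exp (- (\<Sum>i\<in>{1..N}. (s * Z i \<omega>)\<^sup>2) / 2)"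
      by (subst exp_sum[symmetric]) (auto simp: sum_negf sum_divide_distrib)
    moreover have "exp (- real N / 2) \<le> exp (- (\<Sum>i\<in>{1..N}. (s * Z i \<omega>)\<^sup>2) / 2)" using le by simp
    ultimately have "exp (real N / 2) * exp (- real N / 2) \<le> 2 ^ N * (\<Prod>i\<in>{1..N}. exp (- (s * Z i \<omega>)\<^sup>2 / 2))"
      by (intro mult_mono) auto
    then show ?thesis using True by (simp add: exp_add[symmetric])
  next
    case False
    have "0 \<le> 2 ^ N * (\<Prod>i\<in>{1..N}. exp (- (s * Z i \<omega>)\<^sup>2 / 2))"
      by (intro mult_nonneg_nonneg prod_nonneg) auto
    then show ?thesis using False by simp
  qed
  have "M.prob ?A = (\<integral>\<omega>. indicator ?A \<omega> \<partial>M)" using A_meas by simp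
  also have "\<dots> \<le> (\<integral>\<omega>. 2 ^ N * (\<Prod>i\<in>{1..N}. exp (- (s * Z i \<omega>)\<^sup>2 / 2)) \<partial>M)"
  proof (intro integral_mono pw integrable_mult_right)
    show "integrable M (indicator ?A :: _ \<Rightarrow> real)" using A_meas by (simp add: less_top[symmetric])
    show "integrable M (\<lambda>\<omega>. \<Prod>i\<in>{1..N}. exp (- (s * Z i \<omega>)\<^sup>2 / 2))"
      by (intro M.indep_vars_integrable indZ intZ) auto
  qed
  also have "\<dots> = 2 ^ N * (\<Prod>i\<in>{1..N}. \<integral>\<omega>. exp (- (s * Z i \<omega>)\<^sup>2 / 2) \<partial>M)"
    by (subst integral_mult_right_zero, subst M.indep_vars_lebesgue_integral[OF _ indZ intZ]) auto
  also have "\<dots> \<le> 2 ^ N * (\<Prod>i\<in>{1..N}. C / P)"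
    by (intro mult_left_mono prod_mono conjI row integral_nonneg) auto
  also have "\<dots> = (2 * C / P) ^ N" by (simp add: power_mult_distrib power_divide)
  finally show ?thesis .
qed

section \<open>Norms of the columns\<close>

definition colsq :: "nat \<Rightarrow> 'w \<Rightarrow> real" where
  "colsq j \<omega> = (\<Sum>i\<in>{1..N}. (X \<omega> i j)\<^sup>2)"

lemma colsq_nonneg: "colsq j \<omega> \<ge> 0" by (simp add: colsq_def sum_nonneg)

lemma colsq_measurable [measurable]: "j \<in> {1..n} \<Longrightarrow> colsq j \<in> borel_measurable M"
  unfolding colsq_def by measurable

lemma indep_colsq: "M.indep_vars (\<lambda>_. borel) colsq {1..n}"
proof (rule indep_blocks[where K = "\<lambda>j. {1..N} \<times> {j}" and Y = "\<lambda>j f. \<Sum>i\<in>{1..N}. (f (i, j))\<^sup>2"])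
  show "\<And>j. j \<in> {1..n} \<Longrightarrow> {1..N} \<times> {j} \<subseteq> {1..N} \<times> {1..n}" by auto
  show "disjoint_family_on (\<lambda>j. {1..N} \<times> {j}) {1..n}" by (auto simp: disjoint_family_on_def)
  show "(\<lambda>f. \<Sum>i\<in>{1..N}. (f (i, j))\<^sup>2 :: real) \<in> borel_measurable (PiM ({1..N} \<times> {j}) (\<lambda>_. borel))" for j
  proof -
    have [measurable]: "(\<lambda>f. f (i, j)) \<in> borel_measurable (PiM ({1..N} \<times> {j}) (\<lambda>_. borel))"
      if "i \<in> {1..N}" for i using that by (intro measurable_component_singleton) auto
    show ?thesis by measurable
  qed
qed (simp add: colsq_def)

text \<open>Markov's inequality for the sum of the capped squares, which is at least 1 when the
  column norm exceeds \<open>T\<close>: either one entry reaches the cap, or no square is capped and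
  the sum is \<open>colsq j \<omega> / T\<^sup>2\<close>.\<close>

lemma colsq_tail:
  assumes C: "capped_moment_bound C" and T: "T \<ge> T\<^sub>0" and j: "j \<in> {1..n}"
  shows "M.prob {\<omega>\<in>space M. colsq j \<omega> > T\<^sup>2} \<le> real N * C * T powr (-\<alpha>)"
proof -
  have T0: "T > 0" using T T0_pos by linarith
  let ?A = "{\<omega>\<in>space M. colsq j \<omega> > T\<^sup>2}"
  let ?g = "\<lambda>x. min 1 ((x / T)\<^sup>2)"
  have A: "?A \<in> sets M" using j by measurable
  have int: "integrable M (\<lambda>\<omega>. ?g (X \<omega> i j))" if "i \<in> {1..N}" for i
    using that j by (intro M.integrable_const_bound[of _ 1]) auto
  have pw: "indicator ?A \<omega> \<le> (\<Sum>i\<in>{1..N}. ?g (X \<omega> i j))" for \<omega>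
  proof (cases "\<omega> \<in> ?A")
    case True
    have "1 \<le> (\<Sum>i\<in>{1..N}. ?g (X \<omega> i j))"
    proof (cases "\<exists>i\<in>{1..N}. (X \<omega> i j / T)\<^sup>2 \<ge> 1")
      case True
      then obtain i where i: "i \<in> {1..N}" "(X \<omega> i j / T)\<^sup>2 \<ge> 1" by blast
      then have "1 \<le> ?g (X \<omega> i j)" by simp
      also have "\<dots> \<le> (\<Sum>i\<in>{1..N}. ?g (X \<omega> i j))" by (rule member_le_sum) (use i in auto)
      finally show ?thesis .
    next
      case False
      then have "?g (X \<omega> i j) = (X \<omega> i j / T)\<^sup>2" if "i \<in> {1..N}" for i
        using that by (meson less_imp_le min_absorb2 not_le)
      then have "(\<Sum>i\<in>{1..N}. ?g (X \<omega> i j)) = (\<Sum>i\<in>{1..N}. (X \<omega> i j / T)\<^sup>2)"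
        by (intro sum.cong refl)
      also have "\<dots> = colsq j \<omega> / T\<^sup>2" by (simp add: colsq_def power_divide sum_divide_distrib)
      also have "\<dots> \<ge> 1" using True T0 by simp
      finally show ?thesis .
    qed
    then show ?thesis using True by simp
  qed (auto intro!: sum_nonneg)
  have "M.prob ?A = (\<integral>\<omega>. indicator ?A \<omega> \<partial>M)" using A by simp
  also have "\<dots> \<le> (\<integral>\<omega>. (\<Sum>i\<in>{1..N}. ?g (X \<omega> i j)) \<partial>M)"
    using A by (intro integral_mono pw Bochner_Integration.integrable_sum int)
      (auto simp: less_top[symmetric])
  also have "\<dots> = (\<Sum>i\<in>{1..N}. \<integral>\<omega>. ?g (X \<omega> i j) \<partial>M)"
    by (intro Bochner_Integration.integral_sum int) auto
  also have "\<dots> = (\<Sum>i\<in>{1..N}. \<integral>x. ?g x \<partial>\<mu>)"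
    by (intro sum.cong refl entry_integral j) auto
  also have "\<dots> \<le> (\<Sum>i\<in>{1..N}. C * T powr (-\<alpha>))"
    using C T by (intro sum_mono) (auto simp: capped_moment_bound_def)
  finally show ?thesis by simp
qed

lemma colsq_joint_tail:
  assumes C: "capped_moment_bound C" and J: "J \<subseteq> {1..n}" and T: "\<And>j. j \<in> J \<Longrightarrow> T j \<ge> T\<^sub>0"
  shows "M.prob {\<omega>\<in>space M. \<forall>j\<in>J. colsq j \<omega> > (T j)\<^sup>2} \<le> (\<Prod>j\<in>J. real N * C * T j powr (-\<alpha>))"
proof (cases "J = {}")
  case True
  then show ?thesis by simp
next
  case False
  have fin: "finite J" using J finite_subset by blast
  have "{\<omega>\<in>space M. \<forall>j\<in>J. colsq j \<omega> > (T j)\<^sup>2} = (\<Inter>j\<in>J. colsq j -` {(T j)\<^sup>2<..} \<inter> space M)"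
    using False by auto
  also have "M.prob \<dots> = (\<Prod>j\<in>J. M.prob (colsq j -` {(T j)\<^sup>2<..} \<inter> space M))"
    by (rule M.indep_varsD[OF indep_colsq False fin J]) auto
  also have "\<dots> \<le> (\<Prod>j\<in>J. real N * C * T j powr (-\<alpha>))"
  proof (intro prod_mono conjI)
    fix j assume j: "j \<in> J"
    have "colsq j -` {(T j)\<^sup>2<..} \<inter> space M = {\<omega>\<in>space M. colsq j \<omega> > (T j)\<^sup>2}" by auto
    then show "M.prob (colsq j -` {(T j)\<^sup>2<..} \<inter> space M) \<le> real N * C * T j powr (-\<alpha>)"
      using colsq_tail[OF C T[OF j], of j] j J by auto
  qed auto
  finally show ?thesis .
qed

text \<open>The event that no entry exceeds \<open>T\<close> costs \<open>q ^ N\<close>, and a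
  first-moment bound restricted to it does the rest. In the intended use
  \<open>N * T powr (-\<alpha>)\<close> grows like \<open>ln n\<close>, where the estimate
  \<open>colsq_tail\<close> is eventually vacuous, while the lower bound here decays only
  polynomially in \<open>n\<close>.\<close>

lemma colsq_small:
  assumes C: "capped_moment_bound C" and T: "T \<ge> T\<^sub>0" and j: "j \<in> {1..n}" and m: "m > 0"
    and N: "N \<ge> 1"
  defines "q \<equiv> 1 - prob {x. \<bar>x\<bar> > T}"
  shows "M.prob {\<omega>\<in>space M. colsq j \<omega> \<le> m * T\<^sup>2} \<ge> q ^ (N - 1) * (q - real N * C * T powr (-\<alpha>) / m)"
proof -
  have T0: "T > 0" using T T0_pos by linarith
  let ?A = "{\<omega>\<in>space M. colsq j \<omega> \<le> m * T\<^sup>2}"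
  have A: "?A \<in> sets M" using j by measurable
  define f where "f x = (indicator {x::real. \<bar>x\<bar> \<le> T} x :: real)" for x
  define g where "g x = (x / T)\<^sup>2 * f x" for x
  have [measurable]: "f \<in> borel_measurable borel" "g \<in> borel_measurable borel"
    unfolding f_def g_def by measurable
  have f01: "0 \<le> f x" "f x \<le> 1" for x by (auto simp: f_def)
  have g01: "0 \<le> g x" "g x \<le> 1" "g x \<le> min 1 ((x / T)\<^sup>2)" for x
  proof -
    show "0 \<le> g x" using f01 by (simp add: g_def)
    have "(x / T)\<^sup>2 \<le> 1" if "\<bar>x\<bar> \<le> T"
      using that T0 by (simp add: power_divide divide_le_eq abs_le_square_iff[symmetric])
    then show "g x \<le> 1" "g x \<le> min 1 ((x / T)\<^sup>2)"  by (auto simp: g_def f_def indicator_def)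
  qed
  define h where "h k i = (if i = k then g else f)" for k i :: nat
  have h_meas[measurable]: "h k i \<in> borel_measurable borel" for k i by (simp add: h_def)
  have h01: "0 \<le> h k i x" "h k i x \<le> 1" for k i x using f01 g01 by (auto simp: h_def)
  have ind: "M.indep_vars (\<lambda>_. borel) (\<lambda>i \<omega>. h k i (X \<omega> i j)) {1..N}" for k
  proof (rule indep_blocks)
    show "\<And>i. i \<in> {1..N} \<Longrightarrow> {(i, j)} \<subseteq> {1..N} \<times> {1..n}" using j by auto
    show "disjoint_family_on (\<lambda>i. {(i, j)}) {1..N}" by (auto simp: disjoint_family_on_def)
    show "(\<lambda>f. h k i (f (i, j))) \<in> borel_measurable (PiM {(i, j)} (\<lambda>_. borel))" for i
      by measurable
  qed auto
  have inth: "integrable M (\<lambda>\<omega>. h k i (X \<omega> i j))" if "i \<in> {1..N}" for k i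
  proof (rule M.integrable_const_bound[of _ 1])
    show "(\<lambda>\<omega>. h k i (X \<omega> i j)) \<in> borel_measurable M"
      using measurable_compose[OF entry_measurable[OF that j] h_meas] by simp
  qed (use h01 in auto)
  have intp: "integrable M (\<lambda>\<omega>. \<Prod>i\<in>{1..N}. h k i (X \<omega> i j))" for k
    by (intro M.indep_vars_integrable ind inth) auto
  define e where "e = (\<integral>x. g x \<partial>\<mu>)"
  have q_eq: "(\<integral>x. f x \<partial>\<mu>) = q"
  proof -
    have eq: "{x::real. \<bar>x\<bar> \<le> T} = UNIV - {x. \<bar>x\<bar> > T}" by auto
    have "(\<integral>x. f x \<partial>\<mu>) = prob {x::real. \<bar>x\<bar> \<le> T}" unfolding f_def by simp
    also have "\<dots> = q" unfolding eq q_def using prob_compl[of "{x. \<bar>x\<bar> > T}"] by (simp add: space_eq_univ)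
    finally show ?thesis .
  qed
  have q0: "q \<ge> 0" using prob_le_1 by (simp add: q_def)
  have e: "0 \<le> e" "e \<le> C * T powr (-\<alpha>)"
  proof -
    show "0 \<le> e" unfolding e_def using g01(1) by (rule Bochner_Integration.integral_nonneg)
    have "e \<le> (\<integral>x. min 1 ((x / T)\<^sup>2) \<partial>\<mu>)" unfolding e_def
      using g01 by (intro integral_mono integrable_const_bound[of _ 1]) auto
    then show "e \<le> C * T powr (-\<alpha>)" using C T by (fastforce simp: capped_moment_bound_def)
  qed
  have Ep: "(\<integral>\<omega>. (\<Prod>i\<in>{1..N}. h k i (X \<omega> i j)) \<partial>M) = (\<Prod>i\<in>{1..N}. if i = k then e else q)" for k
  proof -
    have "(\<integral>\<omega>. (\<Prod>i\<in>{1..N}. h k i (X \<omega> i j)) \<partial>M) = (\<Prod>i\<in>{1..N}. \<integral>\<omega>. h k i (X \<omega> i j) \<partial>M)"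
      by (intro M.indep_vars_lebesgue_integral ind inth) auto
    also have "\<dots> = (\<Prod>i\<in>{1..N}. if i = k then e else q)"
    proof (intro prod.cong refl)
      fix i assume "i \<in> {1..N}"
      then have "(\<integral>\<omega>. h k i (X \<omega> i j) \<partial>M) = (\<integral>x. h k i x \<partial>\<mu>)" by (intro entry_integral j) auto
      then show "(\<integral>\<omega>. h k i (X \<omega> i j) \<partial>M) = (if i = k then e else q)" by (simp add: h_def e_def q_eq)
    qed
    finally show ?thesis .
  qed
  have E0: "(\<integral>\<omega>. (\<Prod>i\<in>{1..N}. h 0 i (X \<omega> i j)) \<partial>M) = q ^ N"
    unfolding Ep by (subst prod.cong[OF refl, of _ _ "\<lambda>_. q"]) auto
  have E1: "(\<integral>\<omega>. (\<Prod>i\<in>{1..N}. h k i (X \<omega> i j)) \<partial>M) = e * q ^ (N - 1)" if "k \<in> {1..N}" for k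
    unfolding Ep using that by (subst prod.remove[of _ k]) (auto simp: prod.If_cases)
  \<comment> \<open>On the event that no entry exceeds \<open>T\<close>, the indicator of \<open>S \<le> m T\<^sup>2\<close> is at least
     \<open>1 - S / (m T\<^sup>2)\<close>, and \<open>S\<close> restricted to that event is a sum of products of independent factors.
     As \<open>0 \<notin> {1..N}\<close>, the index \<open>k = 0\<close> stands for the product of the indicators alone.\<close>
  have pw: "(\<Prod>i\<in>{1..N}. h 0 i (X \<omega> i j)) - (\<Sum>k\<in>{1..N}. \<Prod>i\<in>{1..N}. h k i (X \<omega> i j)) / m \<le> indicator ?A \<omega>"
    if "\<omega> \<in> space M" for \<omega>
  proof (cases "\<forall>i\<in>{1..N}. \<bar>X \<omega> i j\<bar> \<le> T")
    case False
    then obtain i where i: "i \<in> {1..N}" "\<bar>X \<omega> i j\<bar> > T" by force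
    then have "h 0 i (X \<omega> i j) = 0" by (auto simp: h_def f_def)
    then have "(\<Prod>i\<in>{1..N}. h 0 i (X \<omega> i j)) = 0" using i by auto
    moreover have "0 \<le> (\<Sum>k\<in>{1..N}. \<Prod>i\<in>{1..N}. h k i (X \<omega> i j)) / m"
      using m h01 by (intro divide_nonneg_pos sum_nonneg prod_nonneg) auto
    moreover have "indicator ?A \<omega> \<ge> (0::real)" by simp
    ultimately show ?thesis by linarith
  next
    case True
    have "(\<Prod>i\<in>{1..N}. h 0 i (X \<omega> i j)) = 1"
      using True by (intro prod.neutral) (auto simp: h_def f_def)
    moreover have "(\<Prod>i\<in>{1..N}. h k i (X \<omega> i j)) = (X \<omega> k j / T)\<^sup>2" if "k \<in> {1..N}" for k
    proof -
      have "(\<Prod>i\<in>{1..N} - {k}. h k i (X \<omega> i j)) = 1"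
        using True by (intro prod.neutral) (auto simp: h_def f_def)
      then show ?thesis using that True by (subst prod.remove[of _ k]) (auto simp: h_def g_def f_def)
    qed
    then have "(\<Sum>k\<in>{1..N}. \<Prod>i\<in>{1..N}. h k i (X \<omega> i j)) = colsq j \<omega> / T\<^sup>2"
      by (simp add: colsq_def power_divide sum_divide_distrib)
    moreover have "1 - colsq j \<omega> / T\<^sup>2 / m \<le> indicator ?A \<omega>"
      using that T0 m colsq_nonneg[of j \<omega>] by (auto simp: indicator_def field_simps)
    ultimately show ?thesis by simp
  qed
  have "q ^ (N - 1) * (q - real N * C * T powr (-\<alpha>) / m) \<le> q ^ (N - 1) * (q - real N * e / m)"
    using q0 e m by (intro mult_left_mono diff_left_mono divide_right_mono) (auto simp: mult.assoc intro: mult_left_mono)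
  also have "\<dots> = q ^ N - real N * (e * q ^ (N - 1)) / m"
    using N by (cases N) (auto simp: algebra_simps)
  also have "\<dots> = (\<integral>\<omega>. (\<Prod>i\<in>{1..N}. h 0 i (X \<omega> i j)) - (\<Sum>k\<in>{1..N}. \<Prod>i\<in>{1..N}. h k i (X \<omega> i j)) / m \<partial>M)"
  proof -
    have "(\<integral>\<omega>. (\<Sum>k\<in>{1..N}. \<Prod>i\<in>{1..N}. h k i (X \<omega> i j)) \<partial>M)
        = (\<Sum>k\<in>{1..N}. \<integral>\<omega>. (\<Prod>i\<in>{1..N}. h k i (X \<omega> i j)) \<partial>M)"
      by (intro Bochner_Integration.integral_sum intp)
    also have "\<dots> = (\<Sum>k\<in>{1..N}. e * q ^ (N - 1))" by (intro sum.cong refl E1)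
    finally show ?thesis
      by (subst Bochner_Integration.integral_diff)
        (auto intro!: intp[simplified] integrable_divide_zero Bochner_Integration.integrable_sum simp: E0[simplified])
  qed
  also have "\<dots> \<le> (\<integral>\<omega>. indicator ?A \<omega> \<partial>M)"
    using A intp by (intro integral_mono pw) (auto simp: less_top[symmetric])
  also have "\<dots> = M.prob ?A" using A by simp
  finally show ?thesis .
qed

lemma no_small_column:
  assumes p: "\<And>j. j \<in> {1..n} \<Longrightarrow> M.prob {\<omega>\<in>space M. colsq j \<omega> \<le> B} \<ge> p" and n: "n \<ge> 1"
  shows "M.prob {\<omega>\<in>space M. \<forall>j\<in>{1..n}. colsq j \<omega> > B} \<le> (1 - p) ^ n"
proof -
  have "{\<omega>\<in>space M. \<forall>j\<in>{1..n}. colsq j \<omega> > B} = (\<Inter>j\<in>{1..n}. colsq j -` {B<..} \<inter> space M)"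
    using n by auto
  also have "M.prob \<dots> = (\<Prod>j\<in>{1..n}. M.prob (colsq j -` {B<..} \<inter> space M))"
    by (rule M.indep_varsD[OF indep_colsq]) (use n in auto)
  also have "\<dots> \<le> (\<Prod>j\<in>{1..n}. 1 - p)"
  proof (intro prod_mono conjI)
    fix j assume j: "j \<in> {1..n}"
    have "{\<omega>\<in>space M. colsq j \<omega> \<le> B} \<in> sets M" using j by measurable
    moreover have "colsq j -` {B<..} \<inter> space M = space M - {\<omega>\<in>space M. colsq j \<omega> \<le> B}" by auto
    ultimately show "M.prob (colsq j -` {B<..} \<inter> space M) \<le> 1 - p"
      using M.prob_compl p[OF j] by simp
  qed auto
  finally show ?thesis by simp
qed

end

section \<open>Rounding and lattice sums\<close>

text \<open>Coordinates are rounded one after another, up or down, so that squared errors add as for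
  orthogonal vectors instead of by the triangle inequality. The steps \<open>\<beta> j\<close> may
  differ, which allows finer rounding along long columns.\<close>

lemma ex_lattice_rounding:
  fixes A :: "nat \<Rightarrow> nat \<Rightarrow> real" and u \<beta> :: "nat \<Rightarrow> real"
  assumes "finite J" "\<And>j. j \<in> J \<Longrightarrow> \<beta> j > 0"
  shows "\<exists>v :: nat \<Rightarrow> int. (\<forall>j\<in>J. \<bar>\<beta> j * v j - u j\<bar> \<le> \<beta> j) \<and>
    (\<Sum>i\<in>I. (\<Sum>j\<in>J. A i j * (\<beta> j * v j - u j))\<^sup>2) \<le> (\<Sum>j\<in>J. (\<beta> j)\<^sup>2 * (\<Sum>i\<in>I. (A i j)\<^sup>2))"
  using assms
proof (induction J rule: finite_induct)
  case empty
  then show ?case by simp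
next
  case (insert k J)
  then obtain v :: "nat \<Rightarrow> int" where v: "\<And>j. j \<in> J \<Longrightarrow> \<bar>\<beta> j * v j - u j\<bar> \<le> \<beta> j"
    "(\<Sum>i\<in>I. (\<Sum>j\<in>J. A i j * (\<beta> j * v j - u j))\<^sup>2) \<le> (\<Sum>j\<in>J. (\<beta> j)\<^sup>2 * (\<Sum>i\<in>I. (A i j)\<^sup>2))"
    by auto
  define z where "z i = (\<Sum>j\<in>J. A i j * (\<beta> j * v j - u j))" for i
  \<comment> \<open>Rounding in the direction that makes the cross term nonpositive.\<close>
  define w where "w = (if (\<Sum>i\<in>I. z i * A i k) \<ge> 0 then \<lfloor>u k / \<beta> k\<rfloor> else \<lceil>u k / \<beta> k\<rceil>)"
  define d where "d = \<beta> k * w - u k"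
  have \<beta>: "\<beta> k > 0" using insert by simp
  have d_eq: "d = \<beta> k * (w - u k / \<beta> k)" using \<beta> by (simp add: d_def algebra_simps)
  have w1: "\<bar>w - u k / \<beta> k\<bar> \<le> 1" 
  proof -
    have "w = \<lfloor>u k / \<beta> k\<rfloor> \<or> w = \<lceil>u k / \<beta> k\<rceil>" by (simp add: w_def)
    then show ?thesis by linarith
  qed
  have d_abs: "\<bar>d\<bar> \<le> \<beta> k"
    unfolding d_eq abs_mult using \<beta> w1 by (simp add: mult_left_le)
  have d_sign: "d * (\<Sum>i\<in>I. z i * A i k) \<le> 0"
  proof (cases "(\<Sum>i\<in>I. z i * A i k) \<ge> 0")
    case True
    then have "w - u k / \<beta> k \<le> 0" unfolding w_def by simp
    then show ?thesis using True \<beta> unfolding d_eq by (simp add: mult_nonneg_nonpos mult_nonpos_nonneg)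
  next
    case False
    then have "w - u k / \<beta> k \<ge> 0" unfolding w_def by simp
    then show ?thesis using False \<beta> unfolding d_eq by (simp add: mult_nonneg_nonpos)
  qed
  define v' where "v' = v(k := w)"
  have split: "(\<Sum>j\<in>insert k J. A i j * (\<beta> j * v' j - u j)) = z i + A i k * d" for i
  proof -
    have "(\<Sum>j\<in>J. A i j * (\<beta> j * v' j - u j)) = z i"
      unfolding z_def using insert.hyps by (intro sum.cong) (auto simp: v'_def)
    then show ?thesis using insert.hyps by (simp add: v'_def d_def)
  qed
  have "(\<Sum>i\<in>I. (z i + A i k * d)\<^sup>2)
      = (\<Sum>i\<in>I. (z i)\<^sup>2) + 2 * (d * (\<Sum>i\<in>I. z i * A i k)) + d\<^sup>2 * (\<Sum>i\<in>I. (A i k)\<^sup>2)"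
    by (simp add: power2_sum sum.distrib sum_distrib_left power_mult_distrib algebra_simps)
  also have "\<dots> \<le> (\<Sum>i\<in>I. (z i)\<^sup>2) + 2 * 0 + (\<beta> k)\<^sup>2 * (\<Sum>i\<in>I. (A i k)\<^sup>2)"
    using d_sign d_abs \<beta> by (intro add_mono mult_left_mono mult_right_mono)
      (auto simp: abs_le_square_iff[symmetric] sum_nonneg)
  also have "\<dots> \<le> (\<Sum>j\<in>insert k J. (\<beta> j)\<^sup>2 * (\<Sum>i\<in>I. (A i j)\<^sup>2))"
    using v(2) insert.hyps by (simp add: z_def)
  finally have "(\<Sum>i\<in>I. (\<Sum>j\<in>insert k J. A i j * (\<beta> j * v' j - u j))\<^sup>2)
      \<le> (\<Sum>j\<in>insert k J. (\<beta> j)\<^sup>2 * (\<Sum>i\<in>I. (A i j)\<^sup>2))" unfolding split .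
  moreover have "\<forall>j\<in>insert k J. \<bar>\<beta> j * v' j - u j\<bar> \<le> \<beta> j"
    using v(1) d_abs insert.hyps by (auto simp: v'_def d_def)
  ultimately show ?case by blast
qed

section \<open>Weighted lattice counts\<close>

lemma prod_le_mean_power:
  fixes y :: "'a \<Rightarrow> real"
  assumes J: "finite J" "J \<noteq> {}" and y: "\<And>j. j \<in> J \<Longrightarrow> y j > 0"
  shows "(\<Prod>j\<in>J. y j) \<le> ((\<Sum>j\<in>J. y j) / card J) ^ card J"
proof -
  define m where "m = (\<Sum>j\<in>J. y j) / card J"
  have c: "real (card J) > 0" using J by (simp add: card_gt_0_iff)
  have m: "m > 0" unfolding m_def using J y c by (intro divide_pos_pos sum_pos) auto
  \<comment> \<open>The inequality \<open>t \<le> exp (t - 1)\<close> is applied to each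
    \<open>y j / m\<close>; the exponents sum to 0 because \<open>m\<close> is the mean.\<close>
  have "(\<Prod>j\<in>J. y j) \<le> (\<Prod>j\<in>J. m * exp (y j / m - 1))"
  proof (intro prod_mono conjI)
    fix j assume j: "j \<in> J"
    have "y j / m \<le> exp (y j / m - 1)" using exp_ge_add_one_self[of "y j / m - 1"] by simp
    then show "y j \<le> m * exp (y j / m - 1)" using m by (simp add: divide_le_eq mult.commute)
  qed (use y in \<open>auto intro: less_imp_le\<close>)
  also have "\<dots> = m ^ card J * exp (\<Sum>j\<in>J. y j / m - 1)"
    by (simp add: prod.distrib exp_sum J)
  also have "(\<Sum>j\<in>J. y j / m - 1) = 0"
  proof -
    have "(\<Sum>j\<in>J. y j) = m * card J" using c by (simp add: m_def)
    then show ?thesis using m by (simp add: sum_subtractf sum_divide_distrib[symmetric])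
  qed
  finally show ?thesis by (simp add: m_def)
qed

text \<open>In \<open>y = v / 2 ^ l\<close> the summand decays like
  \<open>\<bar>y\<bar> powr (- (1 + b))\<close>, which is summable over the integers, and each unit
  interval holds about \<open>2 ^ l\<close> points. The bound is uniform in \<open>B\<close>, so the
  box can be as large as rounding requires.\<close>

lemma lattice_sum_bound:
  fixes \<alpha> b :: real
  assumes "\<alpha> > 0" "b > 0"
  shows "\<exists>C\<ge>1. \<forall>(l::nat) (B::nat).
    (\<Sum>v\<in>{- int B..int B}. (1 + \<bar>real_of_int v / 2 ^ l\<bar> powr \<alpha>) powr (- (1 + b) / \<alpha>)) \<le> C * 2 ^ l"
proof -
  define f where "f y = (1 + \<bar>y\<bar> powr \<alpha>) powr (- (1 + b) / \<alpha>)" for y :: real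
  have f0: "f y \<ge> 0" for y by (simp add: f_def)
  have f_mono: "f y \<le> f x" if "0 \<le> x" "x \<le> y" for x y
    unfolding f_def using that assms
    by (intro powr_mono2') (auto intro!: powr_mono2 add_pos_nonneg simp: divide_nonpos_pos)
  \<comment> \<open>The case \<open>q = 0\<close> is separate because \<open>0 powr x\<close> is 0
    while \<open>f 0 = 1\<close>.\<close>
  have f_le: "f (real q) \<le> (if q = 0 then 1 else 0) + real q powr (- (1 + b))" for q :: nat
  proof (cases "q = 0")
    case False
    have "f (real q) \<le> (real q powr \<alpha>) powr (- (1 + b) / \<alpha>)"
      unfolding f_def using False assms by (intro powr_mono2') (auto simp: divide_nonpos_pos)
    also have "\<dots> = real q powr (- (1 + b))" using assms by (simp add: powr_powr)
    finally show ?thesis using False by simp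
  qed (simp add: f_def)
  have summ: "summable (\<lambda>q. real q powr (- (1 + b)))"
    using assms by (simp add: summable_real_powr_iff)
  define S where "S = (\<Sum>q. real q powr (- (1 + b)))"
  have fsum: "(\<Sum>q<M. f (real q)) \<le> 1 + S" for M
  proof -
    have "(\<Sum>q<M. f (real q)) \<le> (\<Sum>q<M. (if q = 0 then 1 else 0) + real q powr (- (1 + b)))"
      by (intro sum_mono f_le)
    also have "\<dots> = (\<Sum>q<M. if q = 0 then 1 else 0) + (\<Sum>q<M. real q powr (- (1 + b)))"
      by (rule sum.distrib)
    also have "\<dots> \<le> 1 + S" unfolding S_def
      by (intro add_mono sum_le_suminf summ) (auto simp: sum.delta)
    finally show ?thesis .
  qed
  have S: "S \<ge> 0" unfolding S_def by (intro suminf_nonneg summ) auto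
  have nat_bound: "(\<Sum>k\<le>B. f (real k / 2 ^ l)) \<le> 2 ^ l * (1 + S)" for B l :: nat
  proof -
    have "(\<Sum>k\<le>B. f (real k / 2 ^ l)) \<le> (\<Sum>k<Suc B * 2 ^ l. f (real k / 2 ^ l))"
    proof (intro sum_mono2)
      have "Suc B * 1 \<le> Suc B * 2 ^ l" by (intro mult_le_mono2) simp
      then show "{..B} \<subseteq> {..<Suc B * 2 ^ l}" by auto
    qed (auto simp: f0)
    \<comment> \<open>Blocks of \<open>2 ^ l\<close> consecutive indices share the integer part
      \<open>q\<close>, at which the decreasing \<open>f\<close> is evaluated.\<close>
    also have "\<dots> = (\<Sum>q<Suc B. sum (\<lambda>k. f (real k / 2 ^ l)) {q * 2 ^ l..<q * 2 ^ l + 2 ^ l})"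
      by (rule sum.nat_group[symmetric])
    also have "\<dots> \<le> (\<Sum>q<Suc B. sum (\<lambda>k. f (real q)) {q * 2 ^ l..<q * 2 ^ l + 2 ^ l})"
    proof (intro sum_mono f_mono)
      fix q k :: nat assume "k \<in> {q * 2 ^ l..<q * 2 ^ l + 2 ^ l}"
      then have "real (q * 2 ^ l) \<le> real k" unfolding of_nat_le_iff by simp
      then show "real q \<le> real k / 2 ^ l" by (simp add: le_divide_eq)
    qed auto
    also have "\<dots> = 2 ^ l * (\<Sum>q<Suc B. f (real q))" unfolding sum_distrib_left by simp
    also have "\<dots> \<le> 2 ^ l * (1 + S)" by (intro mult_left_mono fsum) auto
    finally show ?thesis .
  qed
  have "(\<Sum>v\<in>{- int B..int B}. f (real_of_int v / 2 ^ l)) \<le> (2 * (1 + S)) * 2 ^ l" for l B :: nat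
  proof -
    have un: "{- int B..int B} = {- int B..-1} \<union> {0..int B}" by auto
    have "(\<Sum>v\<in>{- int B..int B}. f (real_of_int v / 2 ^ l))
        = (\<Sum>v\<in>{- int B..-1}. f (real_of_int v / 2 ^ l)) + (\<Sum>v\<in>{0..int B}. f (real_of_int v / 2 ^ l))"
      unfolding un by (intro sum.union_disjoint) auto
    also have "(\<Sum>v\<in>{- int B..-1}. f (real_of_int v / 2 ^ l)) = (\<Sum>k\<in>{1..B}. f (real k / 2 ^ l))"
      by (rule sum.reindex_bij_witness[of _ "\<lambda>k. - int k" "\<lambda>v. nat (- v)"]) (auto simp: f_def)
    also have "\<dots> \<le> (\<Sum>k\<le>B. f (real k / 2 ^ l))" by (intro sum_mono2) (auto simp: f0)
    also have "(\<Sum>v\<in>{0..int B}. f (real_of_int v / 2 ^ l)) = (\<Sum>k\<le>B. f (real k / 2 ^ l))"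
      by (rule sum.reindex_bij_witness[of _ int nat]) auto
    finally show ?thesis using nat_bound[of l B] by (simp add: algebra_simps)
  qed
  moreover have "2 * (1 + S) \<ge> 1" using S by simp
  ultimately show ?thesis unfolding f_def by blast
qed

text \<open>By the inequality of arithmetic and geometric means the weight \<open>H\<close> dominates a product over the
  coordinates, so the sum over lattice points factorizes.\<close>

lemma weighted_lattice_count:
  fixes \<alpha> b C \<Lambda> :: real and l :: "nat \<Rightarrow> nat" and n N B :: nat
  assumes "\<alpha> > 0" "b > 0" "n \<ge> 1" "\<Lambda> \<ge> 1" and N: "real N \<ge> (1 + 2 * b) * real n"
    and C: "\<And>(l::nat) (B::nat).
      (\<Sum>v\<in>{- int B..int B}. (1 + \<bar>real_of_int v / 2 ^ l\<bar> powr \<alpha>) powr (- (1 + b) / \<alpha>)) \<le> C * 2 ^ l"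
  defines "H \<equiv> \<lambda>v. (\<Sum>j\<in>{1..n}. \<bar>real_of_int (v j) / 2 ^ l j\<bar> powr \<alpha>) / real n"
  defines "V \<equiv> {v \<in> PiE {1..n} (\<lambda>_. {- int B..int B}). H v \<ge> \<Lambda>}"
  shows "(\<Sum>v\<in>V. H v powr (- real N / \<alpha>))
    \<le> (\<Lambda> powr (- b / \<alpha>) * 2 powr ((1 + b) / \<alpha>) * C) ^ n * 2 ^ (\<Sum>j\<in>{1..n}. l j)"
proof -
  let ?P = "PiE {1..n} (\<lambda>_. {- int B..int B})"
  define g where "g v = (\<Prod>j\<in>{1..n}. (1 + \<bar>real_of_int (v j) / 2 ^ l j\<bar> powr \<alpha>) powr (- (1 + b) / \<alpha>))"
    for v :: "nat \<Rightarrow> int"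
  define K where "K = \<Lambda> powr (- b * real n / \<alpha>) * 2 powr ((1 + b) * real n / \<alpha>)"
  have fin: "finite ?P" by (intro finite_PiE) auto
  have le: "H v powr (- real N / \<alpha>) \<le> K * g v" if v: "v \<in> V" for v
  proof -
    have H: "H v \<ge> \<Lambda>" "H v \<ge> 1" using v assms(4) by (auto simp: V_def)
    have pr: "(\<Prod>j\<in>{1..n}. 1 + \<bar>real_of_int (v j) / 2 ^ l j\<bar> powr \<alpha>) \<le> (2 * H v) ^ n"
    proof -
      have "(\<Prod>j\<in>{1..n}. 1 + \<bar>real_of_int (v j) / 2 ^ l j\<bar> powr \<alpha>)
          \<le> ((\<Sum>j\<in>{1..n}. 1 + \<bar>real_of_int (v j) / 2 ^ l j\<bar> powr \<alpha>) / card {1..n}) ^ card {1..n}"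
        using assms(3) by (intro prod_le_mean_power) (auto intro: add_pos_nonneg)
      also have "\<dots> = (1 + H v) ^ n"
        using assms(3) by (simp add: sum.distrib H_def add_divide_distrib)
      also have "\<dots> \<le> (2 * H v) ^ n" using H by (intro power_mono) auto
      finally show ?thesis .
    qed
    have prpos: "0 < (\<Prod>j\<in>{1..n}. 1 + \<bar>real_of_int (v j) / 2 ^ l j\<bar> powr \<alpha>)"
      by (intro prod_pos ballI add_pos_nonneg) auto
    \<comment> \<open>The exponent \<open>(1 + 2 * b) * n\<close> is shared out:
      \<open>b * n\<close> of it becomes a power of \<open>\<Lambda>\<close>, and
      \<open>(1 + b) * n\<close> goes to the product over the coordinates, where it gives enough
      decay for summation.\<close>
    have "H v powr (- real N / \<alpha>) \<le> H v powr (- ((1 + 2 * b) * real n) / \<alpha>)"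
      using H N assms(1) by (intro powr_mono divide_right_mono) auto
    also have "\<dots> = H v powr (- b * real n / \<alpha>) * H v powr (- (1 + b) * real n / \<alpha>)"
      by (simp add: powr_add[symmetric] algebra_simps add_divide_distrib diff_divide_distrib)
    also have "H v powr (- (1 + b) * real n / \<alpha>)
        = 2 powr ((1 + b) * real n / \<alpha>) * (2 * H v) powr (- (1 + b) * real n / \<alpha>)"
    proof -
      define E where "E = (1 + b) * real n / \<alpha>"
      have "- (1 + b) * real n / \<alpha> = - E"
        unfolding E_def mult_minus_left minus_divide_left ..
      moreover have "H v powr (- E) = 2 powr E * (2 * H v) powr (- E)"
        using H by (simp add: powr_mult powr_minus)
      ultimately show ?thesis unfolding E_def by simp
    qed
    also have "(2 * H v) powr (- (1 + b) * real n / \<alpha>) = ((2 * H v) ^ n) powr (- (1 + b) / \<alpha>)"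
    proof -
      have "(2 * H v) ^ n = (2 * H v) powr real n" using H by (subst powr_realpow) auto
      then show ?thesis by (simp only: powr_powr mult.commute times_divide_eq_right)
    qed
    also have "H v powr (- b * real n / \<alpha>) * (2 powr ((1 + b) * real n / \<alpha>) * ((2 * H v) ^ n) powr (- (1 + b) / \<alpha>))
       \<le> \<Lambda> powr (- b * real n / \<alpha>) * (2 powr ((1 + b) * real n / \<alpha>) *
          (\<Prod>j\<in>{1..n}. 1 + \<bar>real_of_int (v j) / 2 ^ l j\<bar> powr \<alpha>) powr (- (1 + b) / \<alpha>))"
      using H assms(1,2,4) pr prpos
      by (intro mult_mono powr_mono2' order.refl) (auto simp: divide_nonpos_pos intro!: divide_nonpos_pos mult_nonpos_nonneg)
    also have "\<dots> = K * g v"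
      unfolding K_def g_def by (subst prod_powr_distrib[symmetric]) (auto simp: mult.assoc intro: add_nonneg_nonneg)
    finally show ?thesis .
  qed
  have C0: "C \<ge> 0"
  proof -
    have "0 \<le> (\<Sum>v\<in>{- int B..int B}. (1 + \<bar>real_of_int v / 2 ^ 0\<bar> powr \<alpha>) powr (- (1 + b) / \<alpha>))"
      by (intro sum_nonneg) auto
    also have "\<dots> \<le> C * 2 ^ 0" by (rule C)
    finally show ?thesis by simp
  qed
  have "(\<Sum>v\<in>V. H v powr (- real N / \<alpha>)) \<le> (\<Sum>v\<in>V. K * g v)" by (intro sum_mono le)
  also have "\<dots> \<le> (\<Sum>v\<in>?P. K * g v)"
    by (intro sum_mono2 fin) (auto simp: V_def K_def g_def intro!: mult_nonneg_nonneg prod_nonneg)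
  also have "\<dots> = K * (\<Sum>v\<in>?P. g v)" by (simp add: sum_distrib_left)
  also have "(\<Sum>v\<in>?P. g v) = (\<Prod>j\<in>{1..n}. \<Sum>v\<in>{- int B..int B}.
      (1 + \<bar>real_of_int v / 2 ^ l j\<bar> powr \<alpha>) powr (- (1 + b) / \<alpha>))"
    unfolding g_def by (rule prod_sum_PiE[symmetric]) auto
  also have "K * \<dots> \<le> K * (\<Prod>j\<in>{1..n}. C * 2 ^ l j)"
    by (intro mult_left_mono prod_mono conjI C sum_nonneg) (auto simp: K_def)
  also have "\<dots> = K * C ^ n * 2 ^ (\<Sum>j\<in>{1..n}. l j)"
    by (simp add: prod.distrib power_sum)
  also have "K * C ^ n = (\<Lambda> powr (- b / \<alpha>) * 2 powr ((1 + b) / \<alpha>) * C) ^ n"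
  proof -
    have "x powr (y * real n / \<alpha>) = (x powr (y / \<alpha>)) ^ n" if "x > 0" for x y
      using that by (simp add: powr_realpow[symmetric] powr_powr)
    from this[of \<Lambda> "- b"] this[of 2 "1 + b"] show ?thesis
      using assms(4) unfolding K_def power_mult_distrib by simp
  qed
  finally show ?thesis .
qed

text \<open>Lowering the exponents greedily until they sum to exactly \<open>m\<close> leaves
  finitely many vectors for the union bound behind \<open>heavy_columns\<close>.\<close>

lemma ex_dominated_composition:
  fixes L :: "'a \<Rightarrow> nat"
  assumes "finite J" "(\<Sum>j\<in>J. L j) \<ge> m"
  shows "\<exists>l \<in> PiE J (\<lambda>_. {0..m}). (\<forall>j\<in>J. l j \<le> L j) \<and> (\<Sum>j\<in>J. l j) = m"
proof -
  have "\<exists>l. (\<forall>j\<in>J. l j \<le> L j) \<and> (\<Sum>j\<in>J. l j) = m"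
    using assms
  proof (induction J arbitrary: m rule: finite_induct)
    case (insert k J)
    define r where "r = min m (L k)"
    have "(\<Sum>j\<in>J. L j) \<ge> m - r" using insert by (auto simp: r_def)
    then obtain l where l: "\<forall>j\<in>J. l j \<le> L j" "(\<Sum>j\<in>J. l j) = m - r"
      using insert.IH by blast
    have "(\<Sum>j\<in>J. (l(k := r)) j) = (\<Sum>j\<in>J. l j)" using insert.hyps by (intro sum.cong) auto
    then have "(\<Sum>j\<in>insert k J. (l(k := r)) j) = m" using insert.hyps l by (simp add: r_def)
    moreover have "\<forall>j\<in>insert k J. (l(k := r)) j \<le> L j" using l by (auto simp: r_def)
    ultimately show ?case by blast
  qed simp
  then obtain l where l: "\<And>j. j \<in> J \<Longrightarrow> l j \<le> L j" "(\<Sum>j\<in>J. l j) = m" by blast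
  have "l j \<le> m" if "j \<in> J" for j
    using member_le_sum[of j J l] that assms l by simp
  then have "restrict l J \<in> PiE J (\<lambda>_. {0..m})" by auto
  moreover have "(\<Sum>j\<in>J. restrict l J j) = m" using l by simp
  ultimately show ?thesis using l by (intro bexI[of _ "restrict l J"]) auto
qed

text \<open>Geometric weights cost a constant per coordinate, which replaces an explicit count of
  exponent vectors with bounded sum.\<close>

lemma sum_PiE_prod_geometric_le:
  fixes r :: real
  assumes "0 < r" "r < 1" "finite J"
  shows "(\<Sum>l\<in>PiE J (\<lambda>_. {0..m}). \<Prod>j\<in>J. r ^ l j) \<le> (1 / (1 - r)) ^ card J"
proof -
  have "(\<Sum>l\<in>PiE J (\<lambda>_. {0..m}). \<Prod>j\<in>J. r ^ l j) = (\<Prod>j\<in>J. \<Sum>k\<in>{0..m}. r ^ k)"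
    using assms by (intro prod_sum_PiE[symmetric]) auto
  also have "\<dots> \<le> (\<Prod>j\<in>J. 1 / (1 - r))"
  proof (intro prod_mono conjI sum_nonneg)
    have "(\<Sum>k\<in>{0..m}. r ^ k) \<le> (\<Sum>k. r ^ k)"
      using assms by (intro sum_le_suminf summable_geometric) auto
    also have "\<dots> = 1 / (1 - r)" using assms by (intro suminf_geometric) auto
    finally show "(\<Sum>k\<in>{0..m}. r ^ k) \<le> 1 / (1 - r)" .
  qed (use assms in auto)
  finally show ?thesis by simp
qed

section \<open>The union bound over the net\<close>

lemma finite_PiE_filter:
  assumes "finite I" "finite A"
  shows "finite {l \<in> PiE I (\<lambda>_. A). Q l}"
proof -
  have "finite (PiE I (\<lambda>_. A))" using assms by (intro finite_PiE) auto
  then show ?thesis by simp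
qed

context heavy_tailed_matrix
begin

text \<open>With \<open>2\<^sup>L R\<close> the least dyadic multiple of \<open>R\<close> that bounds the norm of the \<open>j\<close>-th column,
  \<open>L = L\<^sub>j\<close>, this is the event \<open>\<Sum>\<^sub>j L\<^sub>j \<ge> m\<close>, written as a finite union over the minimal ways in
  which the sum can reach \<open>m\<close>.\<close>

definition heavy_columns :: "nat \<Rightarrow> real \<Rightarrow> 'w set" where
  "heavy_columns m R = (\<Union>l\<in>{l \<in> PiE {1..n} (\<lambda>_. {0..m}). (\<Sum>j\<in>{1..n}. l j) = m}.
     {\<omega>\<in>space M. \<forall>j\<in>{j\<in>{1..n}. l j \<ge> 1}. colsq j \<omega> > (2 ^ (l j - 1) * R)\<^sup>2})"

lemma heavy_columns_event [measurable]: "heavy_columns m R \<in> sets M"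
  unfolding heavy_columns_def by (intro sets.finite_UN finite_PiE_filter) auto

text \<open>The least exponents serve: by minimality the column norm exceeds every smaller dyadic
  multiple of \<open>R\<close>, so a sum of at least \<open>m\<close> would put
  \<open>\<omega>\<close> into one of the events forming \<open>heavy_columns m R\<close>.\<close>

lemma column_exponents:
  assumes "\<omega> \<in> space M" "\<omega> \<notin> heavy_columns m R" "R > 0"
  shows "\<exists>l \<in> PiE {1..n} (\<lambda>_. {0..m}). (\<forall>j\<in>{1..n}. colsq j \<omega> \<le> (2 ^ l j * R)\<^sup>2) \<and> (\<Sum>j\<in>{1..n}. l j) \<le> m"
proof -
  define L where "L j = (LEAST k. colsq j \<omega> \<le> (2 ^ k * R)\<^sup>2)" for j
  have ex: "\<exists>k. colsq j \<omega> \<le> (2 ^ k * R)\<^sup>2" for j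
  proof -
    obtain k where k: "sqrt (colsq j \<omega>) / R < 2 ^ k" using real_arch_pow[of 2] by fastforce
    then have "sqrt (colsq j \<omega>) \<le> 2 ^ k * R" using assms(3) by (simp add: divide_less_eq)
    then have "(sqrt (colsq j \<omega>))\<^sup>2 \<le> (2 ^ k * R)\<^sup>2" using colsq_nonneg by (intro power_mono) auto
    then show ?thesis using colsq_nonneg by auto
  qed
  have L: "colsq j \<omega> \<le> (2 ^ L j * R)\<^sup>2" for j unfolding L_def by (rule LeastI_ex[OF ex])
  have "(\<Sum>j\<in>{1..n}. L j) < m"
  proof (rule ccontr)
    assume "\<not> (\<Sum>j\<in>{1..n}. L j) < m"
    then obtain l where l: "l \<in> PiE {1..n} (\<lambda>_. {0..m})" "\<And>j. j \<in> {1..n} \<Longrightarrow> l j \<le> L j"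
      "(\<Sum>j\<in>{1..n}. l j) = m"
      using ex_dominated_composition[of "{1..n}" m L] by auto
    have "colsq j \<omega> > (2 ^ (l j - 1) * R)\<^sup>2" if "j \<in> {1..n}" "l j \<ge> 1" for j
    proof -
      have "l j - 1 < L j" using l(2)[OF that(1)] that(2) by linarith
      from not_less_Least[OF this[unfolded L_def]] show ?thesis by simp
    qed
    then have "\<omega> \<in> heavy_columns m R"
      unfolding heavy_columns_def using l assms(1) by blast
    then show False using assms(2) by simp
  qed
  moreover have "L j \<le> m" if "j \<in> {1..n}" for j
    using member_le_sum[of j "{1..n}" L] that calculation by simp
  ultimately show ?thesis using L by (intro bexI[of _ "restrict L {1..n}"]) auto
qed

text \<open>Each unit of exponent gains \<open>2 powr (-\<alpha>) = r * r\<close> in probability.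
  One factor \<open>r\<close> per unit yields \<open>r ^ (k * n)\<close>; the other makes the sum
  over exponent vectors converge. A large \<open>k\<close> makes the base as small as
  desired.\<close>

lemma heavy_columns_prob:
  assumes C: "capped_moment_bound C" and R: "R \<ge> T\<^sub>0" and A: "real N * C * R powr (-\<alpha>) \<le> A"
  defines "r \<equiv> 2 powr (- \<alpha> / 2)"
  shows "M.prob (heavy_columns (k * n) R) \<le> (max 1 (A * 2 powr \<alpha>) * (1 / (1 - r)) * r ^ k) ^ n"
proof -
  let ?m = "k * n"
  let ?S = "{l \<in> PiE {1..n} (\<lambda>_. {0..?m}). (\<Sum>j\<in>{1..n}. l j) = ?m}"
  let ?E = "\<lambda>l. {\<omega>\<in>space M. \<forall>j\<in>{j\<in>{1..n}. l j \<ge> 1}. colsq j \<omega> > (2 ^ (l j - 1) * R)\<^sup>2}"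
  define A1 where "A1 = max 1 (A * 2 powr \<alpha>)"
  have r: "0 < r" "r < 1" using alpha_pos powr_less_mono[of "-\<alpha>/2" 0 "2::real"] by (auto simp: r_def)
  have R0: "R > 0" using R T0_pos by linarith
  have fin: "finite ?S" by (rule finite_PiE_filter) auto
  have each: "M.prob (?E l) \<le> A1 ^ n * r ^ ?m * (\<Prod>j\<in>{1..n}. r ^ l j)" if l: "l \<in> ?S" for l
  proof -
    let ?J = "{j\<in>{1..n}. l j \<ge> 1}"
    have "M.prob (?E l) \<le> (\<Prod>j\<in>?J. real N * C * (2 ^ (l j - 1) * R) powr (-\<alpha>))"
    proof (rule colsq_joint_tail[OF C])
      fix j
      have "1 * T\<^sub>0 \<le> 2 ^ (l j - 1) * R" using R T0_pos by (intro mult_mono) auto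
      then show "T\<^sub>0 \<le> 2 ^ (l j - 1) * R" by simp
    qed auto
    \<comment> \<open>\<open>A1\<close> contains \<open>2 powr \<alpha>\<close> because the event
      has \<open>l j - 1\<close> in the exponent, and it is at least 1 so that the coordinates with
      \<open>l j = 0\<close> can be included afterwards.\<close>
    also have "\<dots> \<le> (\<Prod>j\<in>?J. A1 * (r * r) ^ l j)"
    proof (intro prod_mono conjI)
      fix j assume "j \<in> ?J"
      then obtain i where i: "l j = Suc i" by (cases "l j") auto
      have rr: "r * r = 2 powr (-\<alpha>)" by (simp add: r_def powr_add[symmetric])
      have pw: "(2 ^ i :: real) powr (-\<alpha>) = (2 powr (-\<alpha>)) ^ i"
        by (simp add: powr_realpow[symmetric] powr_powr mult.commute)
      have "real N * C * (2 ^ (l j - 1) * R) powr (-\<alpha>) = (real N * C * R powr (-\<alpha>)) * (2 powr (-\<alpha>)) ^ i"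
        using R0 by (simp add: i powr_mult pw)
      also have "\<dots> \<le> A * (2 powr (-\<alpha>)) ^ i" by (intro mult_right_mono A) auto
      also have "\<dots> = (A * 2 powr \<alpha>) * (r * r) ^ l j"
        unfolding rr i by (simp add: powr_minus)
      also have "\<dots> \<le> A1 * (r * r) ^ l j" unfolding A1_def using r by (intro mult_right_mono) auto
      finally show "real N * C * (2 ^ (l j - 1) * R) powr (-\<alpha>) \<le> A1 * (r * r) ^ l j" .
      show "0 \<le> real N * C * (2 ^ (l j - 1) * R) powr (-\<alpha>)"
        using C by (auto simp: capped_moment_bound_def)
    qed
    also have "\<dots> = (\<Prod>j\<in>{1..n}. if l j \<ge> 1 then A1 * (r * r) ^ l j else 1)"
      by (rule prod.inter_filter) auto
    also have "\<dots> \<le> (\<Prod>j\<in>{1..n}. A1 * (r * r) ^ l j)"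
      using r by (intro prod_mono) (auto simp: A1_def Suc_le_eq)
    also have "\<dots> = A1 ^ n * r ^ (\<Sum>j\<in>{1..n}. l j) * (\<Prod>j\<in>{1..n}. r ^ l j)"
      by (simp add: prod.distrib power_mult_distrib power_sum)
    also have "(\<Sum>j\<in>{1..n}. l j) = ?m" using l by simp
    finally show ?thesis .
  qed
  have "M.prob (heavy_columns ?m R) \<le> (\<Sum>l\<in>?S. M.prob (?E l))"
    unfolding heavy_columns_def by (intro M.finite_measure_subadditive_finite fin) auto
  also have "\<dots> \<le> (\<Sum>l\<in>?S. A1 ^ n * r ^ ?m * (\<Prod>j\<in>{1..n}. r ^ l j))" by (intro sum_mono each)
  also have "\<dots> \<le> (\<Sum>l\<in>PiE {1..n} (\<lambda>_. {0..?m}). A1 ^ n * r ^ ?m * (\<Prod>j\<in>{1..n}. r ^ l j))"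
    using r by (intro sum_mono2 finite_PiE) (auto simp: A1_def intro!: mult_nonneg_nonneg prod_nonneg)
  also have "\<dots> = A1 ^ n * r ^ ?m * (\<Sum>l\<in>PiE {1..n} (\<lambda>_. {0..?m}). \<Prod>j\<in>{1..n}. r ^ l j)"
    by (rule sum_distrib_left[symmetric])
  also have "\<dots> \<le> A1 ^ n * r ^ ?m * (1 / (1 - r)) ^ card {1..n}"
    using r by (intro mult_left_mono sum_PiE_prod_geometric_le) (auto simp: A1_def)
  also have "\<dots> = (A1 * (1 / (1 - r)) * r ^ k) ^ n"
    by (simp add: power_mult power_mult_distrib mult_ac power_divide)
  finally show ?thesis by (simp add: A1_def)
qed

text \<open>The net consists of the points \<open>\<eta> v\<^sub>j / 2\<^bsup>l j\<^esup>\<close>: the grid is finer in the directions of heavy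
  columns, which makes the rounding error insensitive to them, while the bound on \<open>\<Sum>\<^sub>j l\<^sub>j\<close> keeps the
  number of points exponential in \<open>n\<close>.\<close>

definition net_exponents :: "nat \<Rightarrow> (nat \<Rightarrow> nat) set" where
  "net_exponents m = {l \<in> PiE {1..n} (\<lambda>_. {0..m}). (\<Sum>j\<in>{1..n}. l j) \<le> m}"

text \<open>\<open>\<Lambda>\<close> measures spread before scaling by \<open>\<eta>\<close>. The
  bound 2 matches the one in \<open>char_prod_bound\<close>, and the box given by \<open>B\<close>
  keeps the union over the net finite.\<close>

definition net_points :: "nat \<Rightarrow> real \<Rightarrow> real \<Rightarrow> (nat \<Rightarrow> nat) \<Rightarrow> (nat \<Rightarrow> int) set" where
  "net_points B \<eta> \<Lambda> l = {v \<in> PiE {1..n} (\<lambda>_. {- int B..int B}).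
     (\<Sum>j\<in>{1..n}. \<bar>real_of_int (v j) / 2 ^ l j\<bar> powr \<alpha>) / real n \<ge> \<Lambda> \<and>
     (\<forall>j\<in>{1..n}. \<bar>\<eta> * (real_of_int (v j) / 2 ^ l j)\<bar> \<le> 2)}"

definition net_failure :: "nat \<Rightarrow> real \<Rightarrow> real \<Rightarrow> real \<Rightarrow> nat \<Rightarrow> 'w set" where
  "net_failure B \<eta> \<Lambda> \<tau> m = (\<Union>l\<in>net_exponents m. \<Union>v\<in>net_points B \<eta> \<Lambda> l.
     {\<omega>\<in>space M. (\<Sum>i\<in>{1..N}. (mat_vec n (X \<omega>) (\<lambda>j. \<eta> * (real_of_int (v j) / 2 ^ l j)) i)\<^sup>2)
        \<le> real N * \<tau>\<^sup>2})"

lemma finite_net: "finite (net_exponents m)" "finite (net_points B \<eta> \<Lambda> l)"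
  unfolding net_exponents_def net_points_def by (intro finite_PiE_filter; simp)+

lemma mat_vec_measurable [measurable]:
  "i \<in> {1..N} \<Longrightarrow> (\<lambda>\<omega>. mat_vec n (X \<omega>) u i) \<in> borel_measurable M"
  unfolding mat_vec_def by measurable

lemma net_failure_event [measurable]: "net_failure B \<eta> \<Lambda> \<tau> m \<in> sets M"
  unfolding net_failure_def by (intro sets.finite_UN finite_net) measurable

text \<open>A point of weight \<open>h\<close> fails with probability at most
  \<open>D ^ N * h powr (- N / \<alpha>)\<close>. Since \<open>N\<close> exceeds \<open>n\<close> by
  a fixed proportion, the weighted lattice count sums these with a gain of
  \<open>\<Lambda> powr (- b / \<alpha>)\<close> per coordinate, and the sum over the exponents
  \<open>l\<close> costs \<open>4 ^ k * 2\<close> per coordinate.\<close>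

lemma net_failure_prob:
  assumes C: "char_prod_bound C \<kappa>" and b: "b > 0" and \<Lambda>: "\<Lambda> \<ge> 1" and \<eta>: "\<eta> > 0" and \<rho>: "\<rho> > 0"
    and n: "n \<ge> 1" and N: "real N \<ge> (1 + 2 * b) * real n" "real N \<le> A * real n"
    and C2: "\<And>(l::nat) (B::nat).
      (\<Sum>v\<in>{- int B..int B}. (1 + \<bar>real_of_int v / 2 ^ l\<bar> powr \<alpha>) powr (- (1 + b) / \<alpha>)) \<le> C\<^sub>2 * 2 ^ l"
    and \<tau>: "\<tau> = \<rho> * \<eta> * real n powr (1 / \<alpha>)" and small: "(2 / (\<rho> * \<eta>))\<^sup>2 \<le> exp (\<kappa> * \<tau>\<^sup>2)"
  shows "M.prob (net_failure B \<eta> \<Lambda> \<tau> (k * n)) \<le>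
    (max 1 (2 * C * \<rho>) powr A * (\<Lambda> powr (- b / \<alpha>) * 2 powr ((1 + b) / \<alpha>) * C\<^sub>2) * 4 ^ k * 2) ^ n"
proof -
  let ?m = "k * n"
  define D where "D = max 1 (2 * C * \<rho>)"
  define K where "K = \<Lambda> powr (- b / \<alpha>) * 2 powr ((1 + b) / \<alpha>) * C\<^sub>2"
  define E where "E l v = {\<omega>\<in>space M. (\<Sum>i\<in>{1..N}. (mat_vec n (X \<omega>)
    (\<lambda>j. \<eta> * (real_of_int (v j) / 2 ^ l j)) i)\<^sup>2) \<le> real N * \<tau>\<^sup>2}" for l :: "nat \<Rightarrow> nat" and v :: "nat \<Rightarrow> int"
  have E_sets: "E l v \<in> sets M" for l v unfolding E_def by measurable
  define H where "H l v = (\<Sum>j\<in>{1..n}. \<bar>real_of_int (v j) / 2 ^ l j\<bar> powr \<alpha>) / real n"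
    for l :: "nat \<Rightarrow> nat" and v :: "nat \<Rightarrow> int"
  have C0: "C > 0" using C by (simp add: char_prod_bound_def)
  have n0: "real n > 0" using n by simp
  have K0: "K \<ge> 0"
  proof -
    have "0 \<le> (\<Sum>v\<in>{- int B..int B}. (1 + \<bar>real_of_int v / 2 ^ 0\<bar> powr \<alpha>) powr (- (1 + b) / \<alpha>))"
      by (intro sum_nonneg) auto
    also have "\<dots> \<le> C\<^sub>2 * 2 ^ 0" by (rule C2)
    finally show ?thesis unfolding K_def by simp
  qed
  have DN: "D ^ N \<le> (D powr A) ^ n"
  proof -
    have D1: "D \<ge> 1" by (simp add: D_def)
    have "D ^ N = D powr real N" using D1 by (simp add: powr_realpow)
    also have "\<dots> \<le> D powr (A * real n)" using D1 N by (intro powr_mono) auto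
    also have "\<dots> = (D powr A) ^ n" using D1 by (simp add: powr_realpow[symmetric] powr_powr)
    finally show ?thesis .
  qed
  have single: "M.prob (E l v) \<le> D ^ N * H l v powr (- real N / \<alpha>)"
    if v: "v \<in> net_points B \<eta> \<Lambda> l" for l v
  proof -
    define h where "h = H l v"
    have h: "h \<ge> \<Lambda>" "h \<ge> 1" using v \<Lambda> by (auto simp: net_points_def h_def H_def)
    have v2: "\<bar>\<eta> * (real_of_int (v j) / 2 ^ l j)\<bar> \<le> 2" if "j \<in> {1..n}" for j
      using v that by (simp add: net_points_def)
    \<comment> \<open>With this \<open>P\<close> the product \<open>P * \<tau>\<close> is exactly
      the quasinorm of the net point with exponent \<open>\<alpha>\<close>, the largest value that
      \<open>small_ball\<close> admits.\<close>
    define P where "P = h powr (1 / \<alpha>) / \<rho>"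
    have P0: "P > 0" using h \<rho> by (simp add: P_def)
    have nh: "(\<Sum>j\<in>{1..n}. \<bar>real_of_int (v j) / 2 ^ l j\<bar> powr \<alpha>) = real n * h"
      using n0 by (simp add: h_def H_def)
    have "M.prob (E l v) \<le> (2 * C / P) ^ N"
      unfolding E_def
    proof (rule small_ball[OF C _ P0 v2])
      show "\<tau> > 0" using \<tau> \<eta> \<rho> n0 by simp
      have "(P * \<tau>) powr \<alpha> = (h powr (1 / \<alpha>) * \<eta> * real n powr (1 / \<alpha>)) powr \<alpha>"
        using \<rho> by (simp add: P_def \<tau> mult.assoc)
      also have "\<dots> = h * \<eta> powr \<alpha> * real n"
        using h \<eta> n0 alpha_pos by (simp add: powr_mult powr_powr)
      also have "\<dots> = \<eta> powr \<alpha> * (\<Sum>j\<in>{1..n}. \<bar>real_of_int (v j) / 2 ^ l j\<bar> powr \<alpha>)"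
        unfolding nh by simp
      also have "\<dots> = (\<Sum>j\<in>{1..n}. \<bar>\<eta> * (real_of_int (v j) / 2 ^ l j)\<bar> powr \<alpha>)"
        unfolding sum_distrib_left using \<eta>
        by (intro sum.cong refl) (simp only: abs_mult powr_mult abs_of_pos)
      finally show "(P * \<tau>) powr \<alpha> \<le> (\<Sum>j\<in>{1..n}. \<bar>\<eta> * (real_of_int (v j) / 2 ^ l j)\<bar> powr \<alpha>)" by simp
      \<comment> \<open>Coordinates of size at most 2 bound \<open>h\<close>, hence
        \<open>P\<close>, from above; \<open>small\<close> then yields the cap on
        \<open>P\<^sup>2\<close>.\<close>
      have "real n * h \<le> (\<Sum>j\<in>{1..n}. (2 / \<eta>) powr \<alpha>)"
        unfolding nh[symmetric]
      proof (intro sum_mono powr_mono2)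
        fix j assume "j \<in> {1..n}"
        from v2[OF this] show "\<bar>real_of_int (v j) / 2 ^ l j\<bar> \<le> 2 / \<eta>"
          unfolding abs_mult using \<eta> by (simp add: le_divide_eq mult.commute)
      qed (use alpha_pos in auto)
      then have "h \<le> (2 / \<eta>) powr \<alpha>" using n0 by simp
      then have "h powr (1 / \<alpha>) \<le> ((2 / \<eta>) powr \<alpha>) powr (1 / \<alpha>)"
        using h alpha_pos by (intro powr_mono2) auto
      also have "\<dots> = 2 / \<eta>" using \<eta> alpha_pos by (simp add: powr_powr)
      finally have "P \<le> 2 / \<eta> / \<rho>" unfolding P_def using \<rho> by (intro divide_right_mono) auto
      then have "P\<^sup>2 \<le> (2 / (\<rho> * \<eta>))\<^sup>2" using P0 by (intro power_mono) (auto simp: mult.commute)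
      then show "P\<^sup>2 \<le> exp (\<kappa> * \<tau>\<^sup>2)" using small by linarith
    qed
    also have "2 * C / P = (2 * C * \<rho>) * h powr (- 1 / \<alpha>)"
      using h by (simp add: P_def powr_minus divide_inverse)
    also have "(\<dots>) ^ N \<le> (D * h powr (- 1 / \<alpha>)) ^ N"
      using C0 \<rho> by (intro power_mono mult_right_mono) (auto simp: D_def)
    also have "\<dots> = D ^ N * h powr (- real N / \<alpha>)"
      using h by (simp add: power_mult_distrib powr_realpow[symmetric] powr_powr)
    finally show ?thesis by (simp add: h_def)
  qed
  have inner: "(\<Sum>v\<in>net_points B \<eta> \<Lambda> l. M.prob (E l v)) \<le> (D powr A) ^ n * (K ^ n * 2 ^ (\<Sum>j\<in>{1..n}. l j))" for l
  proof -
    let ?V = "{v \<in> PiE {1..n} (\<lambda>_. {- int B..int B}). H l v \<ge> \<Lambda>}"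
    have sub: "net_points B \<eta> \<Lambda> l \<subseteq> ?V" by (auto simp: net_points_def H_def)
    have "(\<Sum>v\<in>net_points B \<eta> \<Lambda> l. M.prob (E l v)) \<le> (\<Sum>v\<in>net_points B \<eta> \<Lambda> l. D ^ N * H l v powr (- real N / \<alpha>))"
      by (intro sum_mono single)
    also have "\<dots> \<le> (\<Sum>v\<in>?V. D ^ N * H l v powr (- real N / \<alpha>))"
      by (intro sum_mono2 sub finite_PiE_filter) (auto simp: D_def)
    also have "\<dots> = D ^ N * (\<Sum>v\<in>?V. H l v powr (- real N / \<alpha>))" by (rule sum_distrib_left[symmetric])
    also have "\<dots> \<le> (D powr A) ^ n * (K ^ n * 2 ^ (\<Sum>j\<in>{1..n}. l j))"
    proof (intro mult_mono DN)
      show "(\<Sum>v\<in>?V. H l v powr (- real N / \<alpha>)) \<le> K ^ n * 2 ^ (\<Sum>j\<in>{1..n}. l j)"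
        using weighted_lattice_count[OF alpha_pos b n \<Lambda> N(1) C2, of l B]
        unfolding H_def K_def .
    qed (auto intro!: sum_nonneg)
    finally show ?thesis .
  qed
  have outer: "(\<Sum>l\<in>net_exponents ?m. 2 ^ (\<Sum>j\<in>{1..n}. l j)) \<le> (4 ^ k * 2 :: real) ^ n"
  proof -
    \<comment> \<open>Writing \<open>2 ^ s = 4 ^ s * (1/2) ^ s\<close> with
      \<open>s \<le> ?m\<close> introduces a summable weight on the exponent vectors.\<close>
    have "(\<Sum>l\<in>net_exponents ?m. 2 ^ (\<Sum>j\<in>{1..n}. l j))
        \<le> (\<Sum>l\<in>net_exponents ?m. 4 ^ ?m * (\<Prod>j\<in>{1..n}. (1/2 :: real) ^ l j))"
    proof (rule sum_mono)
      fix l assume l: "l \<in> net_exponents ?m"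
      let ?s = "\<Sum>j\<in>{1..n}. l j"
      have "(2::real) ^ ?s = 4 ^ ?s * (1/2) ^ ?s" by (simp add: power_mult_distrib[symmetric])
      also have "\<dots> \<le> 4 ^ ?m * (1/2) ^ ?s"
        using l by (intro mult_right_mono power_increasing) (auto simp: net_exponents_def)
      finally show "(2::real) ^ ?s \<le> 4 ^ ?m * (\<Prod>j\<in>{1..n}. (1/2) ^ l j)" by (simp add: power_sum)
    qed
    also have "\<dots> \<le> (\<Sum>l\<in>PiE {1..n} (\<lambda>_. {0..?m}). 4 ^ ?m * (\<Prod>j\<in>{1..n}. (1/2 :: real) ^ l j))"
      by (intro sum_mono2 finite_PiE) (auto simp: net_exponents_def intro!: mult_nonneg_nonneg prod_nonneg)
    also have "\<dots> = 4 ^ ?m * (\<Sum>l\<in>PiE {1..n} (\<lambda>_. {0..?m}). (\<Prod>j\<in>{1..n}. (1/2 :: real) ^ l j))"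
      by (rule sum_distrib_left[symmetric])
    also have "\<dots> \<le> 4 ^ ?m * (1 / (1 - 1/2)) ^ card {1..n}"
      by (intro mult_left_mono sum_PiE_prod_geometric_le) auto
    also have "\<dots> = (4 ^ k * 2 :: real) ^ n" by (simp add: power_mult power_mult_distrib)
    finally show ?thesis .
  qed
  have "M.prob (net_failure B \<eta> \<Lambda> \<tau> ?m) \<le> (\<Sum>l\<in>net_exponents ?m. M.prob (\<Union>v\<in>net_points B \<eta> \<Lambda> l. E l v))"
    unfolding net_failure_def E_def[symmetric]
    by (intro M.finite_measure_subadditive_finite finite_net image_subsetI sets.finite_UN E_sets)
  also have "\<dots> \<le> (\<Sum>l\<in>net_exponents ?m. \<Sum>v\<in>net_points B \<eta> \<Lambda> l. M.prob (E l v))"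
    by (intro sum_mono M.finite_measure_subadditive_finite finite_net image_subsetI E_sets)
  also have "\<dots> \<le> (\<Sum>l\<in>net_exponents ?m. (D powr A) ^ n * (K ^ n * 2 ^ (\<Sum>j\<in>{1..n}. l j)))"
    by (intro sum_mono inner)
  also have "\<dots> = (D powr A) ^ n * (K ^ n * (\<Sum>l\<in>net_exponents ?m. 2 ^ (\<Sum>j\<in>{1..n}. l j)))"
    by (simp only: sum_distrib_left)
  also have "\<dots> \<le> (D powr A) ^ n * (K ^ n * (4 ^ k * 2) ^ n)"
    using K0 by (intro mult_left_mono outer) auto
  also have "\<dots> = (D powr A * K * 4 ^ k * 2) ^ n" by (simp add: power_mult_distrib mult_ac)
  finally show ?thesis unfolding D_def K_def .
qed

end

section \<open>Localization of the bottom singular vector\<close>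

lemma s_min_le_column:
  assumes "j \<in> {1..n}"
  shows "s_min N n A \<le> sqrt (\<Sum>i\<in>{1..N}. (A i j)\<^sup>2)"
proof -
  define e where "e = (\<lambda>i. if i = j then 1 else 0 :: real)"
  have e: "L2_set e {1..n} = 1"
    using assms by (simp add: L2_set_def e_def if_distrib[of "\<lambda>x. x\<^sup>2"] cong: if_cong)
  have "s_min N n A \<le> L2_set (mat_vec n A e) {1..N}"
    unfolding s_min_def using e by (intro cINF_lower bdd_belowI2[of _ 0]) auto
  also have "mat_vec n A e = (\<lambda>i. A i j)"
    using assms by (simp add: mat_vec_def e_def fun_eq_iff if_distrib[of "\<lambda>x. _ * x"] cong: if_cong)
  finally show ?thesis by (simp add: L2_set_def)
qed

text \<open>More than \<open>\<delta>\<close> of the mass lies on coordinates of size at most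
  \<open>\<theta>\<close>, and there \<open>(u j)\<^sup>2\<close> is at most
  \<open>\<theta> powr (2 - \<alpha>)\<close> times
  \<open>\<bar>u j\<bar> powr \<alpha>\<close>.\<close>

lemma sum_powr_ge_if_spread:
  assumes u: "L2_set u {1..n} = 1" and I: "L2_set u (I_hat c n u) < sqrt (1 - \<delta>)"
    and \<theta>: "\<theta> = sqrt (c * ln (real n) / real n)" "\<theta> > 0" and \<alpha>: "0 < \<alpha>" "\<alpha> < 2"
  shows "\<delta> * \<theta> powr (\<alpha> - 2) \<le> (\<Sum>j\<in>{1..n}. \<bar>u j\<bar> powr \<alpha>)"
proof -
  let ?I = "I_hat c n u"
  have sub: "?I \<subseteq> {1..n}" by (auto simp: I_hat_def)
  have tot: "(\<Sum>j\<in>{1..n}. (u j)\<^sup>2) = 1" using u by (simp add: L2_set_def)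
  have "(\<Sum>j\<in>?I. (u j)\<^sup>2) < 1 - \<delta>" using I by (simp add: L2_set_def)
  moreover have "(\<Sum>j\<in>{1..n}. (u j)\<^sup>2) = (\<Sum>j\<in>{1..n} - ?I. (u j)\<^sup>2) + (\<Sum>j\<in>?I. (u j)\<^sup>2)"
    by (rule sum.subset_diff[OF sub]) auto
  ultimately have "\<delta> \<le> (\<Sum>j\<in>{1..n} - ?I. (u j)\<^sup>2)" using tot by linarith
  also have "\<dots> \<le> (\<Sum>j\<in>{1..n} - ?I. \<theta> powr (2 - \<alpha>) * \<bar>u j\<bar> powr \<alpha>)"
  proof (rule sum_mono)
    fix j assume "j \<in> {1..n} - ?I"
    then have uj: "\<bar>u j\<bar> \<le> \<theta>" by (auto simp: I_hat_def \<theta>)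
    show "(u j)\<^sup>2 \<le> \<theta> powr (2 - \<alpha>) * \<bar>u j\<bar> powr \<alpha>"
    proof (cases "u j = 0")
      case False
      have "(u j)\<^sup>2 = \<bar>u j\<bar> powr 2" using False by (simp add: powr_numeral)
      also have "\<dots> = \<bar>u j\<bar> powr (2 - \<alpha>) * \<bar>u j\<bar> powr \<alpha>" by (simp only: powr_add[symmetric]) simp
      also have "\<dots> \<le> \<theta> powr (2 - \<alpha>) * \<bar>u j\<bar> powr \<alpha>"
        using uj \<alpha> by (intro mult_right_mono powr_mono2) auto
      finally show ?thesis .
    qed auto
  qed
  also have "\<dots> \<le> (\<Sum>j\<in>{1..n}. \<theta> powr (2 - \<alpha>) * \<bar>u j\<bar> powr \<alpha>)" by (intro sum_mono2) auto
  also have "\<dots> = \<theta> powr (2 - \<alpha>) * (\<Sum>j\<in>{1..n}. \<bar>u j\<bar> powr \<alpha>)" by (rule sum_distrib_left[symmetric])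
  finally have "\<delta> * \<theta> powr (\<alpha> - 2) \<le> \<theta> powr (2 - \<alpha>) * (\<Sum>j\<in>{1..n}. \<bar>u j\<bar> powr \<alpha>) * \<theta> powr (\<alpha> - 2)"
    by (intro mult_right_mono) auto
  also have "\<dots> = (\<Sum>j\<in>{1..n}. \<bar>u j\<bar> powr \<alpha>) * (\<theta> powr (2 - \<alpha>) * \<theta> powr (\<alpha> - 2))" by simp
  also have "\<theta> powr (2 - \<alpha>) * \<theta> powr (\<alpha> - 2) = 1"
    using \<theta>(2) by (simp only: powr_add[symmetric]) simp
  finally show ?thesis by simp
qed

context heavy_tailed_matrix
begin

text \<open>The deterministic part: given one short column, no excess of heavy columns and no
  failure in the net, a spread-out \<open>u\<close> would round to a net point \<open>w\<close> with
  \<open>X w\<close> too short, a contradiction.\<close>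

lemma bottom_singular_vector_localized:
  fixes u :: "nat \<Rightarrow> real"
  assumes \<omega>: "\<omega> \<in> space M" and u: "bottom_singular_vector N n (X \<omega>) u"
    and n: "ln (real n) > 0" "n \<le> N" and \<delta>: "0 < \<delta>" and c: "c > 0" "\<Lambda> \<ge> 1" "C\<^sub>0 \<ge> 0"
    and \<eta>: "\<eta> = ln (real n) powr (1/2 - 1/\<alpha>) / sqrt (real n)" "\<eta> \<le> 1"
    and col: "j\<^sub>0 \<in> {1..n}" "colsq j\<^sub>0 \<omega> \<le> (C\<^sub>0 * \<eta> * real n powr (1/\<alpha>))\<^sup>2 * real n"
    and E2: "\<omega> \<notin> heavy_columns m (real n powr (1/\<alpha>))"
    and E3: "\<omega> \<notin> net_failure B \<eta> \<Lambda> ((C\<^sub>0 + 1) * \<eta> * real n powr (1/\<alpha>)) m"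
    and B: "real B \<ge> 2 * 2 ^ m / \<eta>"
    and c_small: "4 * (\<Lambda> + 1) \<le> \<delta> * c powr ((\<alpha> - 2) / 2)"
  shows "L2_set u (I_hat c n u) \<ge> sqrt (1 - \<delta>)"
proof (rule ccontr)
  assume "\<not> ?thesis"
  then have I: "L2_set u (I_hat c n u) < sqrt (1 - \<delta>)" by simp
  have n1: "n \<ge> 1" "real n > 0" using n by (cases n; simp)+
  define D where "D = \<eta> * real n powr (1/\<alpha>) * sqrt (real n)"
  have \<eta>0: "\<eta> > 0" using n n1 by (simp add: \<eta>)
  have D0: "D > 0" using \<eta>0 n1 by (simp add: D_def)
  have u1: "L2_set u {1..n} = 1"
    using u by (simp add: bottom_singular_vector_def right_singular_vector_def)
  have "L2_set (mat_vec n (X \<omega>) u) {1..N} = s_min N n (X \<omega>)"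
    by (rule bottom_singular_vector_attains[OF n1(1) u])
  also have "\<dots> \<le> sqrt (colsq j\<^sub>0 \<omega>)" unfolding colsq_def by (rule s_min_le_column[OF col(1)])
  also have "\<dots> \<le> sqrt ((C\<^sub>0 * D)\<^sup>2)"
    using col(2) n1 by (simp add: D_def power_mult_distrib mult_ac)
  also have "\<dots> = C\<^sub>0 * D" using D0 c by simp
  finally have Xu: "L2_set (mat_vec n (X \<omega>) u) {1..N} \<le> C\<^sub>0 * D" .
  obtain l where l: "l \<in> PiE {1..n} (\<lambda>_. {0..m})" "(\<Sum>j\<in>{1..n}. l j) \<le> m"
    and l_col: "\<And>j. j \<in> {1..n} \<Longrightarrow> colsq j \<omega> \<le> (2 ^ l j * real n powr (1/\<alpha>))\<^sup>2"
    using column_exponents[OF \<omega> E2] n1 by auto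
  define \<beta> where "\<beta> j = \<eta> / 2 ^ l j" for j
  have \<beta>0: "\<beta> j > 0" "\<beta> j \<le> \<eta>" for j using \<eta>0 by (auto simp: \<beta>_def divide_le_eq mult_le_cancel_left1)
  have "\<exists>v :: nat \<Rightarrow> int. (\<forall>j\<in>{1..n}. \<bar>\<beta> j * v j - u j\<bar> \<le> \<beta> j) \<and>
    (\<Sum>i\<in>{1..N}. (\<Sum>j\<in>{1..n}. X \<omega> i j * (\<beta> j * v j - u j))\<^sup>2)
      \<le> (\<Sum>j\<in>{1..n}. (\<beta> j)\<^sup>2 * (\<Sum>i\<in>{1..N}. (X \<omega> i j)\<^sup>2))"
    by (rule ex_lattice_rounding) (use \<beta>0 in auto)
  then obtain v0 :: "nat \<Rightarrow> int" where v0: "\<And>j. j \<in> {1..n} \<Longrightarrow> \<bar>\<beta> j * v0 j - u j\<bar> \<le> \<beta> j"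
    "(\<Sum>i\<in>{1..N}. (\<Sum>j\<in>{1..n}. X \<omega> i j * (\<beta> j * v0 j - u j))\<^sup>2)
      \<le> (\<Sum>j\<in>{1..n}. (\<beta> j)\<^sup>2 * (\<Sum>i\<in>{1..N}. (X \<omega> i j)\<^sup>2))"
    by blast
  define v where "v = restrict v0 {1..n}"
  have v: "\<And>j. j \<in> {1..n} \<Longrightarrow> \<bar>\<beta> j * v j - u j\<bar> \<le> \<beta> j" using v0(1) by (simp add: v_def)
  define w where "w j = \<eta> * (real_of_int (v j) / 2 ^ l j)" for j
  have w: "w j = \<beta> j * v j" for j by (simp add: w_def \<beta>_def)
  have err: "L2_set (\<lambda>i. mat_vec n (X \<omega>) w i - mat_vec n (X \<omega>) u i) {1..N} \<le> D"
  proof -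
    have "(\<Sum>i\<in>{1..N}. (mat_vec n (X \<omega>) w i - mat_vec n (X \<omega>) u i)\<^sup>2)
        = (\<Sum>i\<in>{1..N}. (\<Sum>j\<in>{1..n}. X \<omega> i j * (\<beta> j * v0 j - u j))\<^sup>2)"
      unfolding mat_vec_def sum_subtractf[symmetric] w
      by (intro sum.cong refl arg_cong[where f = "\<lambda>x. x\<^sup>2"]) (simp add: v_def algebra_simps)
    also have "\<dots> \<le> (\<Sum>j\<in>{1..n}. (\<beta> j)\<^sup>2 * colsq j \<omega>)" using v0(2) by (simp add: colsq_def)
    \<comment> \<open>The refinement \<open>2 ^ l j\<close> in \<open>\<beta> j\<close> cancels the
      same factor in the column bound, so every column contributes the same amount.\<close>
    also have "\<dots> \<le> (\<Sum>j\<in>{1..n}. (\<eta> * real n powr (1/\<alpha>))\<^sup>2)"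
    proof (rule sum_mono)
      fix j assume "j \<in> {1..n}"
      then have "(\<beta> j)\<^sup>2 * colsq j \<omega> \<le> (\<beta> j)\<^sup>2 * (2 ^ l j * real n powr (1/\<alpha>))\<^sup>2"
        by (intro mult_left_mono l_col) auto
      also have "\<dots> = (\<eta> * real n powr (1/\<alpha>))\<^sup>2"
        unfolding power_mult_distrib[symmetric] by (simp add: \<beta>_def)
      finally show "(\<beta> j)\<^sup>2 * colsq j \<omega> \<le> (\<eta> * real n powr (1/\<alpha>))\<^sup>2" .
    qed
    also have "\<dots> = D\<^sup>2" using n1 by (simp add: D_def power_mult_distrib)
    finally have "L2_set (\<lambda>i. mat_vec n (X \<omega>) w i - mat_vec n (X \<omega>) u i) {1..N} \<le> sqrt (D\<^sup>2)"
      unfolding L2_set_def by (rule real_sqrt_le_mono)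
    then show ?thesis using D0 by simp
  qed
  have "L2_set (mat_vec n (X \<omega>) w) {1..N}
      \<le> L2_set (mat_vec n (X \<omega>) u) {1..N} + L2_set (\<lambda>i. mat_vec n (X \<omega>) w i - mat_vec n (X \<omega>) u i) {1..N}"
    using L2_set_triangle_ineq[where f = "mat_vec n (X \<omega>) u" and
      g = "\<lambda>i. mat_vec n (X \<omega>) w i - mat_vec n (X \<omega>) u i" and A = "{1..N}"]
    by simp
  also have "\<dots> \<le> (C\<^sub>0 + 1) * D" using Xu err by (simp add: algebra_simps)
  finally have Xw: "L2_set (mat_vec n (X \<omega>) w) {1..N} \<le> (C\<^sub>0 + 1) * D" .
  have "(\<Sum>i\<in>{1..N}. (mat_vec n (X \<omega>) w i)\<^sup>2) = (L2_set (mat_vec n (X \<omega>) w) {1..N})\<^sup>2"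
    by (simp add: L2_set_def sum_nonneg)
  also have "\<dots> \<le> ((C\<^sub>0 + 1) * D)\<^sup>2" by (intro power_mono Xw L2_set_nonneg)
  also have "\<dots> = real n * ((C\<^sub>0 + 1) * \<eta> * real n powr (1/\<alpha>))\<^sup>2"
    using n1 by (simp add: D_def power_mult_distrib mult_ac)
  also have "\<dots> \<le> real N * ((C\<^sub>0 + 1) * \<eta> * real n powr (1/\<alpha>))\<^sup>2"
    using n by (intro mult_right_mono) auto
  finally have small: "(\<Sum>i\<in>{1..N}. (mat_vec n (X \<omega>) w i)\<^sup>2)
    \<le> real N * ((C\<^sub>0 + 1) * \<eta> * real n powr (1/\<alpha>))\<^sup>2" .
  have w2: "\<bar>w j\<bar> \<le> 2" if "j \<in> {1..n}" for j
  proof -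
    have "\<bar>u j\<bar> \<le> L2_set u {1..n}" 
      using member_le_L2_set[of "{1..n}" j "\<lambda>j. \<bar>u j\<bar>"] that by (simp add: L2_set_def)
    then show ?thesis using v[OF that] \<beta>0[of j] \<eta> u1 unfolding w by linarith
  qed
  have "v \<in> PiE {1..n} (\<lambda>_. {- int B..int B})"
  proof -
    have "\<bar>real_of_int (v j)\<bar> \<le> real B" if j: "j \<in> {1..n}" for j
    proof -
      have "\<eta> * \<bar>real_of_int (v j)\<bar> / 2 ^ l j \<le> 2" using w2[OF j] \<eta>0 by (simp add: w_def abs_mult)
      then have "\<bar>real_of_int (v j)\<bar> \<le> 2 * 2 ^ l j / \<eta>" using \<eta>0 by (simp add: field_simps)
      also have "\<dots> \<le> 2 * 2 ^ m / \<eta>"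
        using l(1) j \<eta>0 by (intro divide_right_mono mult_left_mono power_increasing) auto
      finally show ?thesis using B by linarith
    qed
    then have "\<bar>v j\<bar> \<le> int B" if "j \<in> {1..n}" for j
    proof -
      have "real_of_int \<bar>v j\<bar> \<le> real_of_int (int B)"
        using \<open>\<And>j. j \<in> {1..n} \<Longrightarrow> \<bar>real_of_int (v j)\<bar> \<le> real B\<close>[OF that] by simp
      then show ?thesis by (simp only: of_int_le_iff)
    qed
    then have "v j \<in> {- int B..int B}" if "j \<in> {1..n}" for j
      using that by (fastforce simp: abs_le_iff)
    then show ?thesis by (auto simp: v_def)
  qed
  moreover have "\<Lambda> \<le> (\<Sum>j\<in>{1..n}. \<bar>real_of_int (v j) / 2 ^ l j\<bar> powr \<alpha>) / real n"
  proof -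
    define H where "H = (\<Sum>j\<in>{1..n}. \<bar>real_of_int (v j) / 2 ^ l j\<bar> powr \<alpha>) / real n"
    define \<theta> where "\<theta> = sqrt (c * ln (real n) / real n)"
    have \<theta>0: "\<theta> > 0" using c n n1 by (simp add: \<theta>_def)
    define Q where "Q = real n * \<eta> powr \<alpha>"
    have Q0: "Q > 0" using n1 \<eta>0 by (simp add: Q_def)
    have wsum: "(\<Sum>j\<in>{1..n}. \<bar>w j\<bar> powr \<alpha>) = Q * H"
    proof -
      have "(\<Sum>j\<in>{1..n}. \<bar>w j\<bar> powr \<alpha>) = \<eta> powr \<alpha> * (\<Sum>j\<in>{1..n}. \<bar>real_of_int (v j) / 2 ^ l j\<bar> powr \<alpha>)"
        unfolding sum_distrib_left w_def using \<eta>0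
        by (intro sum.cong refl) (simp only: abs_mult powr_mult abs_of_pos)
      then show ?thesis using n1 by (simp add: H_def Q_def)
    qed
    have "\<delta> * \<theta> powr (\<alpha> - 2) \<le> (\<Sum>j\<in>{1..n}. \<bar>u j\<bar> powr \<alpha>)"
      by (rule sum_powr_ge_if_spread[OF u1 I \<theta>_def \<theta>0 alpha_pos alpha_less])
    \<comment> \<open>Rounding moves each coordinate by at most \<open>\<eta>\<close>, so the power
      sum passes from \<open>u\<close> to \<open>w\<close> with the constant
      \<open>4 \<ge> 2 powr \<alpha>\<close> and an extra \<open>\<eta> powr \<alpha>\<close> per
      coordinate.\<close>
    also have "\<dots> \<le> (\<Sum>j\<in>{1..n}. 4 * (\<bar>w j\<bar> powr \<alpha> + \<eta> powr \<alpha>))"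
    proof (rule sum_mono)
      fix j assume j: "j \<in> {1..n}"
      have "\<bar>u j\<bar> \<le> 2 * max \<bar>w j\<bar> \<eta>" using v[OF j] \<beta>0[of j] unfolding w by linarith
      then have "\<bar>u j\<bar> powr \<alpha> \<le> (2 * max \<bar>w j\<bar> \<eta>) powr \<alpha>" using alpha_pos by (intro powr_mono2) auto
      also have "\<dots> = 2 powr \<alpha> * max \<bar>w j\<bar> \<eta> powr \<alpha>" using \<eta>0 by (intro powr_mult)
      also have "\<dots> \<le> 4 * (\<bar>w j\<bar> powr \<alpha> + \<eta> powr \<alpha>)"
      proof (intro mult_mono)
        have "(2::real) powr \<alpha> \<le> 2 powr 2" using alpha_less by (intro powr_mono) auto
        then show "(2::real) powr \<alpha> \<le> 4" by simp
      qed (auto simp: max_def)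
      finally show "\<bar>u j\<bar> powr \<alpha> \<le> 4 * (\<bar>w j\<bar> powr \<alpha> + \<eta> powr \<alpha>)" .
    qed
    also have "\<dots> = 4 * (Q * H + Q)"
      unfolding sum_distrib_left[symmetric] sum.distrib wsum by (simp add: Q_def)
    \<comment> \<open>The mesh \<open>\<eta>\<close> is chosen for this identity: the powers of
      \<open>n\<close> and \<open>ln n\<close> are exactly \<open>Q\<close>, which cancels and
      leaves only constants to compare.\<close>
    also have "\<theta> powr (\<alpha> - 2) = c powr ((\<alpha> - 2) / 2) * Q"
    proof -
      have "\<theta> powr (\<alpha> - 2) = ((c * ln (real n) / real n) powr (1/2)) powr (\<alpha> - 2)"
        using c n n1 by (simp add: \<theta>_def powr_half_sqrt)
      also have "\<dots> = c powr ((\<alpha> - 2) / 2) * (ln (real n) powr ((\<alpha> - 2) / 2) / real n powr ((\<alpha> - 2) / 2))"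
        using c n n1 by (simp add: powr_powr powr_mult powr_divide)
      also have "ln (real n) powr ((\<alpha> - 2) / 2) / real n powr ((\<alpha> - 2) / 2) = Q"
      proof -
        have e1: "(1/2 - 1/\<alpha>) * \<alpha> = (\<alpha> - 2) / 2" using alpha_pos by (simp add: field_simps)
        have "\<eta> powr \<alpha> = ln (real n) powr ((\<alpha> - 2) / 2) / real n powr (\<alpha> / 2)"
          using n n1 by (simp add: \<eta> powr_divide powr_powr e1 powr_half_sqrt[symmetric])
        moreover have "real n / real n powr (\<alpha> / 2) = 1 / real n powr ((\<alpha> - 2) / 2)"
        proof -
          have "real n powr 1 / real n powr (\<alpha> / 2) = real n powr (- ((\<alpha> - 2) / 2))"
            unfolding powr_diff[symmetric] by (simp add: diff_divide_distrib)
          then show ?thesis using n1 by (simp add: powr_minus_divide)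
        qed
        ultimately show ?thesis unfolding Q_def
          by (metis (no_types, opaque_lifting) mult.commute mult.right_neutral times_divide_eq_right)
      qed
      finally show ?thesis .
    qed
    finally have "\<delta> * c powr ((\<alpha> - 2) / 2) * Q \<le> 4 * (H + 1) * Q" by (simp add: algebra_simps)
    then have "\<delta> * c powr ((\<alpha> - 2) / 2) \<le> 4 * (H + 1)" using Q0 by simp
    then have "\<Lambda> \<le> H" using c_small by argo
    then show ?thesis unfolding H_def .
  qed
  ultimately have "v \<in> net_points B \<eta> \<Lambda> l" using w2 by (simp add: net_points_def w_def)
  moreover have "l \<in> net_exponents m" using l by (simp add: net_exponents_def)
  ultimately have "\<omega> \<in> net_failure B \<eta> \<Lambda> ((C\<^sub>0 + 1) * \<eta> * real n powr (1/\<alpha>)) m"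
    unfolding net_failure_def using \<omega> small unfolding w_def by blast
  then show False using E3 by simp
qed

text \<open>For \<open>T\<close> of order \<open>(n / ln n) powr (1/\<alpha>)\<close> a single
  column has no entry above \<open>T\<close>, and is short, with probability at least of order
  \<open>n powr (- 1/4)\<close>. Among \<open>n\<close> independent columns the expected number of
  short ones is then at least of order \<open>n powr (3/4)\<close>.\<close>

lemma no_small_column_prob:
  assumes C: "capped_moment_bound C" and a: "a \<ge> 1" and N: "n \<le> N" "real N \<le> 2 * a * real n"
    and ln: "ln (real n) > 0" and S: "S = 16 * a * C\<^sub>u"
    and T: "(S * real n / ln (real n)) powr (1/\<alpha>) \<ge> T\<^sub>0"
    and half: "C\<^sub>u * ln (real n) / (S * real n) \<le> 1/2"
    and C0: "C\<^sub>0 = sqrt (8 * a * C * S powr (2/\<alpha> - 1))"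
    and \<eta>: "\<eta> = ln (real n) powr (1/2 - 1/\<alpha>) / sqrt (real n)"
  shows "M.prob {\<omega>\<in>space M. \<forall>j\<in>{1..n}. colsq j \<omega> > (C\<^sub>0 * \<eta> * real n powr (1/\<alpha>))\<^sup>2 * real n}
    \<le> exp (- (real n powr (3/4)) / 4)"
proof -
  have n1: "n \<ge> 1" "real n > 0" using ln by (cases n; simp)+
  have S0: "S > 0" using S a Cu_pos by simp
  have Cp: "C > 0" using C by (simp add: capped_moment_bound_def)
  define T where "T = (S * real n / ln (real n)) powr (1/\<alpha>)"
  have Tp: "T \<ge> T\<^sub>0" "T > 0" using T T0_pos unfolding T_def by linarith+
  have Ta: "T powr (-\<alpha>) = ln (real n) / (S * real n)"
    unfolding T_def powr_powr using alpha_pos S0 n1 ln by (simp add: powr_minus divide_inverse mult_ac)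
  \<comment> \<open>Chosen so that the loss in \<open>colsq_small\<close> is at most 1/4; as
    \<open>q \<ge> 1/2\<close>, at least 1/4 remains.\<close>
  define m where "m = 8 * a * C * ln (real n) / S"
  have m0: "m > 0" using a Cp ln S0 by (simp add: m_def)
  define q where "q = 1 - prob {x. \<bar>x\<bar> > T}"
  define y where "y = C\<^sub>u * ln (real n) / (S * real n)"
  have y: "0 \<le> y" "y \<le> 1/2" using half Cu_pos ln S0 n1 by (auto simp: y_def)
  have q: "q \<ge> 1 - y" "q \<le> 1" "q \<ge> 1/2"
  proof -
    show "q \<ge> 1 - y" using tail_upper[OF Tp(1)] unfolding Ta q_def y_def by simp
    then show "q \<ge> 1/2" using y by linarith
  qed (auto simp: q_def)
  \<comment> \<open>As \<open>y\<close> bounds the tail probability at \<open>T\<close>, the factor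
    16 in \<open>S\<close> gives \<open>2 * y * N \<le> ln n / 4\<close>, and
    \<open>1 - y \<ge> exp (- 2 * y)\<close> for \<open>y \<le> 1/2\<close> turns this into the
    power \<open>- 1/4\<close>.\<close>
  have qN: "q ^ (N - 1) \<ge> real n powr (- 1/4)"
  proof -
    have ey: "exp (- 2 * y) \<le> 1 - y"
    proof -
      have "1 / (1 - y) = 1 + y / (1 - y)" using y by (simp add: field_simps)
      also have "\<dots> \<le> 1 + 2 * y"
      proof -
        have "y / (1 - y) \<le> y / (1/2)" using y by (intro divide_left_mono) auto
        then show ?thesis by simp
      qed
      also have "\<dots> \<le> exp (2 * y)" by (rule exp_ge_add_one_self)
      finally have "1 / (1 - y) \<le> exp (2 * y)" .
      then show ?thesis using y by (simp add: exp_minus field_simps)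
    qed
    have "2 * y * real N \<le> 2 * y * (2 * a * real n)" using N y by (intro mult_left_mono) auto
    also have "\<dots> = ln (real n) / 4" using n1 Cu_pos a by (simp add: y_def S)
    finally have yN: "2 * y * real N \<le> ln (real n) / 4" .
    have "real n powr (- 1/4) = exp (- (ln (real n) / 4))" using n1 by (simp add: powr_def)
    also have "\<dots> \<le> exp (- (2 * y * real N))" using yN by simp
    also have "\<dots> = exp (- 2 * y) ^ N" by (simp add: exp_of_nat_mult[symmetric] mult_ac)
    also have "\<dots> \<le> q ^ N" using ey q by (intro power_mono) auto
    also have "\<dots> \<le> q ^ (N - 1)" using q by (intro power_decreasing) auto
    finally show ?thesis .
  qed
  have quarter: "q - real N * C * T powr (-\<alpha>) / m \<ge> 1/4"
  proof -
    have "real N * C * T powr (-\<alpha>) / m \<le> (2 * a * real n) * C * T powr (-\<alpha>) / m"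
      using N Cp m0 by (intro divide_right_mono mult_right_mono) auto
    also have "\<dots> = 1/4" unfolding Ta m_def using n1 a Cp ln S0 by (simp add: field_simps)
    finally show ?thesis using q by linarith
  qed
  have level: "m * T\<^sup>2 = (C\<^sub>0 * \<eta> * real n powr (1/\<alpha>))\<^sup>2 * real n"
  proof -
    have sq: "(x powr (1/\<alpha>))\<^sup>2 = x powr (2/\<alpha>)" if "x > 0" for x :: real
      using that by (simp add: powr_realpow[symmetric] powr_powr)
    have A: "T\<^sup>2 = S powr (2/\<alpha>) * real n powr (2/\<alpha>) / ln (real n) powr (2/\<alpha>)"
      unfolding T_def using S0 n1 ln by (subst sq) (auto simp: powr_mult powr_divide)
    have B: "C\<^sub>0\<^sup>2 = 8 * a * C * (S powr (2/\<alpha>) / S)"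
      unfolding C0 using a Cp S0 by (simp add: powr_diff)
    have "(ln (real n) powr (1/2 - 1/\<alpha>))\<^sup>2 = ln (real n) powr (1 - 2/\<alpha>)"
      using ln by (simp add: powr_realpow[symmetric] powr_powr algebra_simps)
    moreover have "\<eta>\<^sup>2 * real n = (ln (real n) powr (1/2 - 1/\<alpha>))\<^sup>2"
      unfolding \<eta> using n1 by (simp add: power_divide)
    ultimately have E: "\<eta>\<^sup>2 * real n = ln (real n) / ln (real n) powr (2/\<alpha>)"
      using ln by (simp add: powr_diff)
    have "(C\<^sub>0 * \<eta> * real n powr (1/\<alpha>))\<^sup>2 * real n = C\<^sub>0\<^sup>2 * (\<eta>\<^sup>2 * real n) * real n powr (2/\<alpha>)"
      using n1 by (simp add: power_mult_distrib sq)
    also have "\<dots> = m * T\<^sup>2" unfolding A B E m_def by simp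
    finally show ?thesis by simp
  qed
  define p where "p = real n powr (- 1/4) / 4"
  have p1: "p \<le> 1"
  proof -
    have "real n powr (- 1/4) \<le> real n powr 0" using n1 by (intro powr_mono) auto
    then show ?thesis using n1 by (simp add: p_def)
  qed
  have "M.prob {\<omega>\<in>space M. \<forall>j\<in>{1..n}. colsq j \<omega> > m * T\<^sup>2} \<le> (1 - p) ^ n"
  proof (rule no_small_column[OF _ n1(1)])
    fix j assume j: "j \<in> {1..n}"
    have N1: "N \<ge> 1" using N n1 by simp
    have "p = real n powr (- 1/4) * (1/4)" by (simp add: p_def)
    also have "\<dots> \<le> q ^ (N - 1) * (q - real N * C * T powr (-\<alpha>) / m)"
      using qN quarter q by (intro mult_mono) auto
    also have "\<dots> \<le> M.prob {\<omega>\<in>space M. colsq j \<omega> \<le> m * T\<^sup>2}"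
      unfolding q_def by (rule colsq_small[OF C Tp(1) j m0 N1])
    finally show "p \<le> M.prob {\<omega>\<in>space M. colsq j \<omega> \<le> m * T\<^sup>2}" .
  qed
  also have "\<dots> \<le> exp (- p) ^ n"
    using p1 exp_ge_add_one_self[of "- p"] by (intro power_mono) auto
  also have "\<dots> = exp (- (real n powr (3/4)) / 4)"
  proof -
    have "real n * p = real n powr 1 * real n powr (- 1/4) / 4" using n1 by (simp add: p_def)
    also have "\<dots> = real n powr (3/4) / 4" by (simp only: powr_add[symmetric]) simp
    finally show ?thesis by (simp add: exp_of_nat_mult[symmetric])
  qed
  finally show ?thesis by (simp add: level)
qed

end

section \<open>Asymptotics of the scales\<close>

lemma eventually_scale_conditions:
  fixes \<beta> \<kappa> \<rho> S T C K :: real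
  assumes \<beta>: "\<beta> > 1/2" and "\<kappa> > 0" "\<rho> > 0" "S > 0" "K > 0" "C > 0"
  defines "\<eta> \<equiv> \<lambda>n::nat. ln (real n) powr (1/2 - \<beta>) / sqrt (real n)"
  shows "\<forall>\<^sub>F n in sequentially. 1 \<le> ln (real n) \<and> T \<le> real n powr \<beta> \<and>
    T \<le> (S * real n / ln (real n)) powr \<beta> \<and> C * ln (real n) / (S * real n) \<le> 1/2 \<and>
    (2 / (\<rho> * \<eta> n))\<^sup>2 \<le> exp (\<kappa> * (\<rho> * \<eta> n * real n powr \<beta>)\<^sup>2) \<and>
    exp (- (real n powr (3/4)) / 4) + 2 * exp (- real n) \<le> real n powr (- K)"
proof -
  \<comment> \<open>In the application \<open>\<beta> = 1 / \<alpha>\<close>, and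
    \<open>\<gamma> > 0\<close> expresses \<open>\<alpha> < 2\<close>.\<close>
  define \<gamma> where "\<gamma> = \<beta> - 1/2"
  have \<gamma>: "\<gamma> > 0" using \<beta> by (simp add: \<gamma>_def)
  have \<beta>0: "\<beta> > 0" using \<beta> by simp
  have 1: "\<forall>\<^sub>F n::nat in sequentially. 1 \<le> ln (real n)" by real_asymp
  have "filterlim (\<lambda>n::nat. real n powr \<beta>) at_top sequentially" using \<beta>0 by real_asymp
  then have 2: "\<forall>\<^sub>F n::nat in sequentially. T \<le> real n powr \<beta>" by (simp add: filterlim_at_top)
  have "filterlim (\<lambda>n::nat. (S * real n / ln (real n)) powr \<beta>) at_top sequentially"
    using \<beta>0 assms(4) by real_asymp
  then have 3: "\<forall>\<^sub>F n::nat in sequentially. T \<le> (S * real n / ln (real n)) powr \<beta>"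
    by (simp add: filterlim_at_top)
  have "((\<lambda>n::nat. C * ln (real n) / (S * real n)) \<longlongrightarrow> 0) sequentially"
    using assms(4,6) by real_asymp
  then have 4: "\<forall>\<^sub>F n::nat in sequentially. C * ln (real n) / (S * real n) < 1/2"
    by (rule order_tendstoD) simp
  \<comment> \<open>The condition on \<open>\<eta>\<close> and \<open>\<kappa>\<close> in terms of
    \<open>\<gamma>\<close>: the left side is linear in \<open>n\<close> up to logarithms, the right
    side exponential in a power of \<open>n / ln n\<close>.\<close>
  have 5: "\<forall>\<^sub>F n::nat in sequentially. 4 * real n * ln (real n) powr (2 * \<gamma>) / \<rho>\<^sup>2
      \<le> exp (\<kappa> * \<rho>\<^sup>2 * (real n / ln (real n)) powr (2 * \<gamma>))"
    using \<gamma> assms(2,3) by real_asymp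
  have 6: "\<forall>\<^sub>F n::nat in sequentially. exp (- (real n powr (3/4)) / 4) + 2 * exp (- real n) \<le> real n powr (- K)"
    using assms(5) by real_asymp
  from 1 2 3 4 5 6 show ?thesis
  proof eventually_elim
    case (elim n)
    have "n \<noteq> 0" using elim(1) by (intro notI) simp
    moreover have "ln (real n) > 0" using elim(1) by linarith
    ultimately have n: "real n > 0" "ln (real n) > 0" by simp_all
    have \<eta>: "\<eta> n = 1 / (ln (real n) powr \<gamma> * sqrt (real n))"
    proof -
      have "1/2 - \<beta> = - \<gamma>" by (simp add: \<gamma>_def)
      then show ?thesis unfolding \<eta>_def by (simp only: powr_minus_divide divide_divide_eq_left)
    qed
    have sq: "(x powr \<gamma>)\<^sup>2 = x powr (2 * \<gamma>)" if "x > 0" for x :: real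
      using that by (simp add: powr_realpow[symmetric] powr_powr mult.commute)
    have "(2 / (\<rho> * \<eta> n))\<^sup>2 = 4 * real n * ln (real n) powr (2 * \<gamma>) / \<rho>\<^sup>2"
      using n by (simp add: \<eta> power_mult_distrib power_divide sq)
    moreover have "(\<rho> * \<eta> n * real n powr \<beta>)\<^sup>2 = \<rho>\<^sup>2 * (real n / ln (real n)) powr (2 * \<gamma>)"
    proof -
      have "real n powr \<beta> = real n powr \<gamma> * sqrt (real n)"
        using n by (simp add: powr_half_sqrt[symmetric] powr_add[symmetric] \<gamma>_def)
      then have "\<rho> * \<eta> n * real n powr \<beta> = \<rho> * (real n / ln (real n)) powr \<gamma>"
        using n by (simp add: \<eta> powr_divide)
      moreover have "((real n / ln (real n)) powr \<gamma>)\<^sup>2 = (real n / ln (real n)) powr (2 * \<gamma>)"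
        using n by (intro sq) simp
      ultimately show ?thesis by (simp only: power_mult_distrib)
    qed
    ultimately show ?case using elim by (simp add: mult.assoc)
  qed
qed

text \<open>Ties and signs are left open by letting \<open>u\<close> be any measurable choice that
  is almost surely a bottom singular vector. Both \<open>c\<close> and \<open>C\<close> are fixed
  before \<open>n\<close> and the matrix.\<close>

theorem theorem1p4:
  fixes \<mu> :: "real measure" and a \<alpha> C\<^sub>l C\<^sub>u T\<^sub>0 :: real
  assumes "a > 1"
    and "0 < \<alpha>" "\<alpha> < 2"
    and "C\<^sub>l > 0" "C\<^sub>u > 0" "T\<^sub>0 > 0"
    and "real_distribution \<mu>"
    and "heavy_tailed \<mu> \<alpha> C\<^sub>l C\<^sub>u T\<^sub>0"
    and "symmetrically_distributed \<mu>"
  shows "\<forall>\<delta> K :: real. 0 < \<delta> \<and> \<delta> < 1 \<and> 0 < K \<longrightarrow>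
    (\<exists>c>0. \<exists>C. \<forall>n\<ge>1. \<forall>N. N = nat \<lceil>a * real n\<rceil> \<longrightarrow>
      (\<forall>(M :: 'w measure) (X :: 'w \<Rightarrow> nat \<Rightarrow> nat \<Rightarrow> real) (u :: 'w \<Rightarrow> nat \<Rightarrow> real).
        prob_space M \<and> iid_matrix M \<mu> N n X \<and>
        (\<forall>i\<in>{1..n}. (\<lambda>\<omega>. u \<omega> i) \<in> borel_measurable M) \<and>
        (AE \<omega> in M. bottom_singular_vector N n (X \<omega>) (u \<omega>)) \<longrightarrow>
        measure M {\<omega>\<in>space M. L2_set (u \<omega>) (I_hat c n (u \<omega>)) \<ge> sqrt (1 - \<delta>)}
          \<ge> 1 - C * real n powr (-K)))"
proof (intro allI impI)
  fix \<delta> K :: real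
  assume \<delta>K: "0 < \<delta> \<and> \<delta> < 1 \<and> 0 < K"
  interpret law: heavy_tailed_law \<mu> \<alpha> C\<^sub>l C\<^sub>u T\<^sub>0
    using assms by (simp add: heavy_tailed_law_def heavy_tailed_law_axioms_def)
  obtain C\<^sub>3 where C3: "law.capped_moment_bound C\<^sub>3" using law.ex_capped_moment_bound by blast
  then have C3_pos: "C\<^sub>3 > 0" by (simp add: law.capped_moment_bound_def)
  obtain C \<kappa> where C: "law.char_prod_bound C \<kappa>" using law.ex_char_prod_bound by blast
  then have C_pos: "C > 0" "\<kappa> > 0" by (simp_all add: law.char_prod_bound_def)
  \<comment> \<open>The aspect ratio exceeds 1 by \<open>2 * b\<close>; this surplus of rows over
    columns beats the entropy of the net.\<close>
  define b where "b = (a - 1) / 2"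
  have b: "b > 0" "1 + 2 * b = a" using assms(1) by (simp_all add: b_def field_simps)
  obtain C\<^sub>2 where C2: "C\<^sub>2 \<ge> 1" "\<And>(l::nat) (B::nat).
      (\<Sum>v\<in>{- int B..int B}. (1 + \<bar>real_of_int v / 2 ^ l\<bar> powr \<alpha>) powr (- (1 + b) / \<alpha>)) \<le> C\<^sub>2 * 2 ^ l"
    using lattice_sum_bound[OF assms(2) b(1)] by blast
  define r where "r = (2::real) powr (- \<alpha> / 2)"
  have r: "0 < r" "r < 1" using assms(2) powr_less_mono[of "-\<alpha>/2" 0 "2::real"] by (auto simp: r_def)
  define G where "G = max 1 (2 * a * C\<^sub>3 * 2 powr \<alpha>) * (1 / (1 - r))"
  have G: "G > 0" using r by (auto simp: G_def less_max_iff_disj)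
  \<comment> \<open>\<open>k\<close> is the average exponent allowed per column; this choice makes
    an excess of heavy columns exponentially unlikely.\<close>
  obtain k where "r ^ k < exp (- 1) / G"
    using real_arch_pow_inv[of "exp (- 1) / G" r] G r by auto
  then have k: "G * r ^ k \<le> exp (- 1)" using G by (simp add: less_divide_eq mult.commute)
  define S where "S = 16 * a * C\<^sub>u"
  have S: "S > 0" using assms by (simp add: S_def)
  define C\<^sub>0 where "C\<^sub>0 = sqrt (8 * a * C\<^sub>3 * S powr (2/\<alpha> - 1))"
  have C0: "C\<^sub>0 \<ge> 0" using assms C3_pos by (simp add: C\<^sub>0_def)
  define \<rho> where "\<rho> = C\<^sub>0 + 1"
  have \<rho>: "\<rho> > 0" using C0 by (simp add: \<rho>_def)
  \<comment> \<open>\<open>W\<close> collects the factors of the net bound that do not involve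
    \<open>\<Lambda>\<close>, so \<open>\<Lambda>\<close> can be chosen after it.\<close>
  define W where "W = max 1 (2 * C * \<rho>) powr (2 * a) * 2 powr ((1 + b) / \<alpha>) * C\<^sub>2 * 4 ^ k * 2"
  have W: "W > 0" using C2(1) by (simp add: W_def less_max_iff_disj)
  define \<Lambda> where "\<Lambda> = max 1 ((exp 1 * W) powr (\<alpha> / b))"
  have \<Lambda>: "\<Lambda> \<ge> 1" by (simp add: \<Lambda>_def)
  have W\<Lambda>: "\<Lambda> powr (- b / \<alpha>) * W \<le> exp (- 1)"
  proof -
    have "\<Lambda> powr (- b / \<alpha>) \<le> ((exp 1 * W) powr (\<alpha> / b)) powr (- b / \<alpha>)"
      using W b assms(2) by (intro powr_mono2') (auto simp: \<Lambda>_def divide_nonpos_pos)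
    also have "\<dots> = (exp 1 * W) powr (- 1)" using b assms(2) by (simp add: powr_powr)
    also have "\<dots> = exp (- 1) / W" using W by (simp add: powr_minus exp_minus divide_inverse)
    finally show ?thesis using W by (simp add: le_divide_eq)
  qed
  \<comment> \<open>Solves
    \<open>\<delta> * c powr ((\<alpha> - 2) / 2) = 4 * (\<Lambda> + 1)\<close>; the exponent is
    negative, so a large \<open>\<Lambda>\<close> means a small \<open>c\<close>.\<close>
  define c where "c = (\<delta> / (4 * (\<Lambda> + 1))) powr (2 / (2 - \<alpha>))"
  have c: "c > 0" using \<delta>K \<Lambda> by (simp add: c_def)
  have c_small: "4 * (\<Lambda> + 1) \<le> \<delta> * c powr ((\<alpha> - 2) / 2)"
  proof -
    have "2 / (2 - \<alpha>) * ((\<alpha> - 2) / 2) = - 1" using assms(3) by (simp add: field_simps)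
    then have "c powr ((\<alpha> - 2) / 2) = (\<delta> / (4 * (\<Lambda> + 1))) powr (- 1)"
      unfolding c_def powr_powr by simp
    also have "\<dots> = 4 * (\<Lambda> + 1) / \<delta>" using \<delta>K \<Lambda> by (simp add: powr_minus)
    finally show ?thesis using \<delta>K by simp
  qed
  have "1 / \<alpha> > 1 / 2" using assms(2,3) by (simp add: divide_simps)
  from eventually_scale_conditions[OF this C_pos(2) \<rho> S _ assms(5), of K T\<^sub>0] \<delta>K
  obtain n\<^sub>0 where n0: "\<And>n. n \<ge> n\<^sub>0 \<Longrightarrow> 1 \<le> ln (real n) \<and> T\<^sub>0 \<le> real n powr (1/\<alpha>) \<and>
    T\<^sub>0 \<le> (S * real n / ln (real n)) powr (1/\<alpha>) \<and> C\<^sub>u * ln (real n) / (S * real n) \<le> 1/2 \<and>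
    (2 / (\<rho> * (ln (real n) powr (1/2 - 1/\<alpha>) / sqrt (real n))))\<^sup>2
      \<le> exp (\<kappa> * (\<rho> * (ln (real n) powr (1/2 - 1/\<alpha>) / sqrt (real n)) * real n powr (1/\<alpha>))\<^sup>2) \<and>
    exp (- (real n powr (3/4)) / 4) + 2 * exp (- real n) \<le> real n powr (- K)"
    unfolding eventually_sequentially by blast
  \<comment> \<open>For \<open>n < n\<^sub>0\<close> the second argument makes the claimed lower
    bound at most 0; from \<open>n\<^sub>0\<close> on, \<open>Cc \<ge> 1\<close> suffices.\<close>
  define Cc where "Cc = max 1 (real n\<^sub>0 powr K)"
  have main: "measure M {\<omega>\<in>space M. L2_set (u \<omega>) (I_hat c n (u \<omega>)) \<ge> sqrt (1 - \<delta>)}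
          \<ge> 1 - Cc * real n powr (-K)"
    if n1: "n \<ge> 1" and N: "N = nat \<lceil>a * real n\<rceil>" and ps: "prob_space M" and iid: "iid_matrix M \<mu> N n X"
      and u_meas: "\<And>i. i \<in> {1..n} \<Longrightarrow> (\<lambda>\<omega>. u \<omega> i) \<in> borel_measurable M"
      and bottom: "AE \<omega> in M. bottom_singular_vector N n (X \<omega>) (u \<omega>)"
    for n N and M :: "'w measure" and X u
  proof (cases "n \<ge> n\<^sub>0")
    case False
    then have "real n powr K \<le> real n\<^sub>0 powr K" using \<delta>K by (intro powr_mono2) auto
    also have "\<dots> \<le> Cc" by (simp add: Cc_def)
    finally have "1 \<le> Cc * real n powr (- K)" using n1 by (simp add: powr_minus field_simps)
    then show ?thesis using measure_nonneg[of M] by (smt (verit))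
  next
    case True
    note cond = n0[OF True]
    interpret M: prob_space M by (rule ps)
    interpret mx: heavy_tailed_matrix \<mu> \<alpha> C\<^sub>l C\<^sub>u T\<^sub>0 M N n X
      by (intro heavy_tailed_matrix.intro law.heavy_tailed_law_axioms ps heavy_tailed_matrix_axioms.intro iid)
    define \<eta> where "\<eta> = ln (real n) powr (1/2 - 1/\<alpha>) / sqrt (real n)"
    have nN: "n \<le> N" "real N \<ge> a * real n" "real N \<le> 2 * a * real n"
    proof -
      have an: "a * real n \<ge> real n" "a * real n \<ge> 1"
        using assms(1) n1 mult_mono[of 1 a 1 "real n"] by auto
      have N': "real N = real_of_int \<lceil>a * real n\<rceil>" unfolding N using an by simp
      show "real N \<ge> a * real n" unfolding N' by linarith
      then show "n \<le> N" using an by linarith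
      show "real N \<le> 2 * a * real n" unfolding N' using an by linarith
    qed
    have ln_pos: "ln (real n) > 0" using cond by linarith
    have \<eta>: "\<eta> > 0" "\<eta> \<le> 1"
    proof -
      show "\<eta> > 0" using ln_pos n1 by (simp add: \<eta>_def)
      have "ln (real n) powr (1/2 - 1/\<alpha>) \<le> ln (real n) powr 0"
        using cond \<open>1 / \<alpha> > 1 / 2\<close> by (intro powr_mono) auto
      also have "\<dots> = 1" using ln_pos by simp
      also have "1 \<le> sqrt (real n)" using n1 by simp
      finally show "\<eta> \<le> 1" using n1 by (simp add: \<eta>_def)
    qed
    define m where "m = k * n"
    define B where "B = nat \<lceil>2 * 2 ^ m / \<eta>\<rceil>"
    have B: "real B \<ge> 2 * 2 ^ m / \<eta>" by (simp add: B_def of_nat_ceiling)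
    define R where "R = real n powr (1/\<alpha>)"
    \<comment> \<open>The three bad events: no short column, too large a total column exponent, and
      a net point with small image.\<close>
    define E1 where "E1 = {\<omega>\<in>space M. \<forall>j\<in>{1..n}. mx.colsq j \<omega> > (C\<^sub>0 * \<eta> * R)\<^sup>2 * real n}"
    define E2 where "E2 = mx.heavy_columns m R"
    define E3 where "E3 = mx.net_failure B \<eta> \<Lambda> (\<rho> * \<eta> * R) m"
    have sets: "E1 \<in> sets M" "E2 \<in> sets M" "E3 \<in> sets M"
      unfolding E1_def E2_def E3_def by measurable
    have p1: "measure M E1 \<le> exp (- (real n powr (3/4)) / 4)"
      unfolding E1_def R_def
      by (rule mx.no_small_column_prob[OF C3 _ nN(1,3) ln_pos S_def _ _ C\<^sub>0_def \<eta>_def])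
        (use cond assms(1) in auto)
    have exp_n: "exp (- 1) ^ n = exp (- real n)" by (simp add: exp_of_nat_mult[symmetric])
    have p2: "measure M E2 \<le> exp (- real n)"
    proof -
      have "R powr (- \<alpha>) = 1 / real n"
        using assms(2) n1 by (simp add: R_def powr_powr powr_minus divide_inverse)
      then have "real N * C\<^sub>3 * R powr (- \<alpha>) \<le> 2 * a * C\<^sub>3"
        using nN(3) C3_pos n1 by (simp add: divide_le_eq mult_ac)
      moreover have "R \<ge> T\<^sub>0" using cond by (simp add: R_def)
      ultimately have "measure M E2 \<le> (G * r ^ k) ^ n"
        unfolding E2_def m_def G_def r_def by (intro mx.heavy_columns_prob[OF C3])
      also have "\<dots> \<le> exp (- 1) ^ n" using k G r by (intro power_mono) auto
      finally show ?thesis by (simp add: exp_n)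
    qed
    have p3: "measure M E3 \<le> exp (- real n)"
    proof -
      have "measure M E3 \<le> (max 1 (2 * C * \<rho>) powr (2 * a) *
          (\<Lambda> powr (- b / \<alpha>) * 2 powr ((1 + b) / \<alpha>) * C\<^sub>2) * 4 ^ k * 2) ^ n"
        unfolding E3_def m_def
        by (rule mx.net_failure_prob[OF C b(1) \<Lambda> \<eta>(1) \<rho> n1 _ _ C2(2)])
          (use nN cond in \<open>simp_all add: b R_def \<eta>_def\<close>)
      also have "\<dots> = (\<Lambda> powr (- b / \<alpha>) * W) ^ n" by (simp add: W_def mult_ac)
      also have "\<dots> \<le> exp (- 1) ^ n" using W W\<Lambda> by (intro power_mono) auto
      finally show ?thesis by (simp add: exp_n)
    qed
    let ?T = "{\<omega>\<in>space M. L2_set (u \<omega>) (I_hat c n (u \<omega>)) \<ge> sqrt (1 - \<delta>)}"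
    have T_meas: "?T \<in> sets M"
    proof -
      have "L2_set (u \<omega>) (I_hat c n (u \<omega>)) =
        sqrt (\<Sum>j\<in>{1..n}. if \<bar>u \<omega> j\<bar> > sqrt (c * ln (real n) / real n) then (u \<omega> j)\<^sup>2 else 0)" for \<omega>
        unfolding L2_set_def I_hat_def by (subst sum.inter_filter) auto
      moreover note u_meas[measurable]
      ultimately show ?thesis by simp measurable
    qed
    have AE_T: "AE \<omega> in M. \<omega> \<in> space M - (E1 \<union> E2 \<union> E3) \<longrightarrow> \<omega> \<in> ?T"
      using bottom
    proof eventually_elim
      case (elim \<omega>)
      show ?case
      proof
        assume \<omega>: "\<omega> \<in> space M - (E1 \<union> E2 \<union> E3)"
        then obtain j where j: "j \<in> {1..n}" "mx.colsq j \<omega> \<le> (C\<^sub>0 * \<eta> * R)\<^sup>2 * real n"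
          unfolding E1_def by fastforce
        have "sqrt (1 - \<delta>) \<le> L2_set (u \<omega>) (I_hat c n (u \<omega>))"
          using \<omega> j elim \<delta>K ln_pos nN(1) c \<Lambda> C0 \<eta>(2) B c_small
          by (intro mx.bottom_singular_vector_localized[of \<omega> "u \<omega>" \<delta> c \<Lambda> C\<^sub>0 \<eta> j m B])
            (auto simp: E2_def E3_def R_def \<rho>_def \<eta>_def)
        then show "\<omega> \<in> ?T" using \<omega> by simp
      qed
    qed
    have "measure M (E1 \<union> E2 \<union> E3) \<le> measure M E1 + measure M E2 + measure M E3"
      using measure_Un_le[OF sets(1,2)] measure_Un_le[OF sets.Un[OF sets(1,2)] sets(3)] by linarith
    also have "\<dots> \<le> exp (- (real n powr (3/4)) / 4) + 2 * exp (- real n)" using p1 p2 p3 by linarith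
    also have "\<dots> \<le> real n powr (- K)" using cond by blast
    also have "\<dots> \<le> Cc * real n powr (- K)"
      using mult_right_mono[of 1 Cc "real n powr (- K)"] by (simp add: Cc_def)
    finally have "1 - Cc * real n powr (- K) \<le> 1 - measure M (E1 \<union> E2 \<union> E3)" by simp
    also have "\<dots> = measure M (space M - (E1 \<union> E2 \<union> E3))" using sets by (subst M.prob_compl) auto
    also have "\<dots> \<le> measure M ?T" by (rule M.finite_measure_mono_AE[OF AE_T T_meas])
    finally show ?thesis .
  qed
  show "\<exists>c>0. \<exists>C. \<forall>n\<ge>1. \<forall>N. N = nat \<lceil>a * real n\<rceil> \<longrightarrow>
      (\<forall>(M :: 'w measure) (X :: 'w \<Rightarrow> nat \<Rightarrow> nat \<Rightarrow> real) (u :: 'w \<Rightarrow> nat \<Rightarrow> real).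
        prob_space M \<and> iid_matrix M \<mu> N n X \<and>
        (\<forall>i\<in>{1..n}. (\<lambda>\<omega>. u \<omega> i) \<in> borel_measurable M) \<and>
        (AE \<omega> in M. bottom_singular_vector N n (X \<omega>) (u \<omega>)) \<longrightarrow>
        measure M {\<omega>\<in>space M. L2_set (u \<omega>) (I_hat c n (u \<omega>)) \<ge> sqrt (1 - \<delta>)}
          \<ge> 1 - C * real n powr (-K))"
    by (intro exI[of _ c] exI[of _ Cc] conjI c allI impI main) auto
qed

end
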